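(* Let $G$ be a finite graph with $\mathrm{mad}(G)<17/5$. If $L$ is a 6-assignment for $G$ and $\alpha$ and $\beta$ are $L$-colorings of $G$, then $\alpha$ can be transformed to $\beta$ by an $L$-recoloring sequence in which each vertex is recolored at most 12 times (so that every intermediate coloring is a proper $L$-coloring). In particular, this holds for every planar graph of girth at least 5.
   Context: The maximum average degree of $G$ is $\mathrm{mad}(G):=\max_{H\subseteq G,\,V(H)\neq\emptyset}2|E(H)|/|V(H)|$. A list-assignment $L$ for $G$ assigns to each vertex $v$ a set $L(v)$ of colors; $L$ is a $k$-assignment if $|L(v)|=k$ for every $v$. An $L$-coloring is a proper coloring $\varphi$ with $\varphi(v)\in L(v)$ for all $v$. An $L$-recoloring step changes the color of a single vertex so that the resulting coloring is again a proper $L$-coloring. An $L$-recoloring sequence consists of an initial $L$-coloring followed by a sequence of $L$-recoloring steps; it transforms $\alpha$ to $\beta$ if its initial coloring is $\alpha$ and its final coloring is $\beta$. *)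

theory Defs
  imports "HOL-Analysis.Analysis"
begin

definition simple_graph :: "'a set \<Rightarrow> 'a set set \<Rightarrow> bool" where
  "simple_graph V E \<longleftrightarrow> (\<forall>e\<in>E. e \<subseteq> V \<and> card e = 2)"

definition subgraph :: "'a set \<Rightarrow> 'a set set \<Rightarrow> 'a set \<Rightarrow> 'a set set \<Rightarrow> bool" where
  "subgraph W F V E \<longleftrightarrow> simple_graph W F \<and> W \<subseteq> V \<and> F \<subseteq> E"

text \<open>The graph without vertices has no nonempty subgraph; its maximum average degree is
  set to \<open>0\<close>.\<close>

definition mad :: "'a set \<Rightarrow> 'a set set \<Rightarrow> real" where
  "mad V E = (if V = {} then 0
     else Max {2 * real (card F) / real (card W) | W F. subgraph W F V E \<and> W \<noteq> {}})"

definition cycle :: "'a set set \<Rightarrow> 'a list \<Rightarrow> bool" where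
  "cycle E xs \<longleftrightarrow> 3 \<le> length xs \<and> distinct xs \<and>
     successively (\<lambda>u v. {u, v} \<in> E) xs \<and> {last xs, hd xs} \<in> E"

text \<open>An acyclic graph has girth \<open>\<infinity>\<close>, the infimum of the empty set in \<^typ>\<open>enat\<close>.\<close>

definition girth :: "'a set set \<Rightarrow> enat" where
  "girth E = (INF xs\<in>{xs. cycle E xs}. enat (length xs))"

text \<open>A drawing in the plane represents vertices by distinct points and edges by arcs
  (injective continuous paths) joining their end vertices; the relative interior of each
  arc meets neither a vertex nor another arc.\<close>

definition plane_drawing ::
  "'a set \<Rightarrow> 'a set set \<Rightarrow> ('a \<Rightarrow> complex) \<Rightarrow> ('a set \<Rightarrow> real \<Rightarrow> complex) \<Rightarrow> bool" where
  "plane_drawing V E p \<gamma> \<longleftrightarrow> inj_on p V \<and>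
     (\<forall>e\<in>E. arc (\<gamma> e) \<and> {pathstart (\<gamma> e), pathfinish (\<gamma> e)} = p ` e \<and>
        (path_image (\<gamma> e) - p ` e) \<inter> (p ` V \<union> (\<Union>f\<in>E - {e}. path_image (\<gamma> f))) = {})"

definition planar :: "'a set \<Rightarrow> 'a set set \<Rightarrow> bool" where
  "planar V E \<longleftrightarrow> (\<exists>p \<gamma>. plane_drawing V E p \<gamma>)"

definition list_assignment :: "nat \<Rightarrow> 'a set \<Rightarrow> ('a \<Rightarrow> 'c set) \<Rightarrow> bool" where
  "list_assignment k V L \<longleftrightarrow> (\<forall>v\<in>V. finite (L v) \<and> card (L v) = k)"

text \<open>Colorings are functions on \<open>V\<close>, hence extensional: they take the fixed value
  \<^const>\<open>undefined\<close> outside \<open>V\<close>, so that equality of colorings is equality on \<open>V\<close>.\<close>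

definition L_coloring :: "'a set \<Rightarrow> 'a set set \<Rightarrow> ('a \<Rightarrow> 'c set) \<Rightarrow> ('a \<Rightarrow> 'c) \<Rightarrow> bool" where
  "L_coloring V E L \<phi> \<longleftrightarrow> \<phi> \<in> (\<Pi>\<^sub>E v\<in>V. L v) \<and> (\<forall>u v. {u, v} \<in> E \<longrightarrow> \<phi> u \<noteq> \<phi> v)"

definition recoloring_step ::
  "'a set \<Rightarrow> 'a set set \<Rightarrow> ('a \<Rightarrow> 'c set) \<Rightarrow> ('a \<Rightarrow> 'c) \<Rightarrow> ('a \<Rightarrow> 'c) \<Rightarrow> bool" where
  "recoloring_step V E L \<phi> \<psi> \<longleftrightarrow> L_coloring V E L \<phi> \<and> L_coloring V E L \<psi> \<and>
     (\<exists>v\<in>V. \<exists>c. c \<noteq> \<phi> v \<and> \<psi> = \<phi>(v := c))"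

text \<open>A recoloring sequence is the list of all colorings it passes through, including the
  initial and the final one.\<close>

definition recoloring_sequence ::
  "'a set \<Rightarrow> 'a set set \<Rightarrow> ('a \<Rightarrow> 'c set) \<Rightarrow> ('a \<Rightarrow> 'c) list \<Rightarrow> bool" where
  "recoloring_sequence V E L \<phi>s \<longleftrightarrow> \<phi>s \<noteq> [] \<and> L_coloring V E L (hd \<phi>s) \<and>
     successively (recoloring_step V E L) \<phi>s"

definition transforms :: "('a \<Rightarrow> 'c) list \<Rightarrow> ('a \<Rightarrow> 'c) \<Rightarrow> ('a \<Rightarrow> 'c) \<Rightarrow> bool" where
  "transforms \<phi>s \<alpha> \<beta> \<longleftrightarrow> hd \<phi>s = \<alpha> \<and> last \<phi>s = \<beta>"

definition times_recolored :: "('a \<Rightarrow> 'c) list \<Rightarrow> 'a \<Rightarrow> nat" where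
  "times_recolored \<phi>s v = card {i. Suc i < length \<phi>s \<and> (\<phi>s ! Suc i) v \<noteq> (\<phi>s ! i) v}"

end

theory Submission
  imports Defs
begin

text \<open>Colourings are extended from \<open>G - S\<close> to \<open>G\<close>: a vertex of \<open>S\<close> moves only when a neighbour is about to
  take its colour, and then to the colour that stays harmless longest. A vertex of degree at most 2
  needs few moves. For a vertex \<open>v\<close> of degree 3 with two neighbours of degree 3, or of degree 4 with
  four such neighbours, \<open>v\<close> sometimes gives way to its neighbours \<open>w\<close>: the 24 recolourings outside
  \<open>S\<close> that concern \<open>w\<close> then force \<open>2 + 9 = 11\<close> moves, as \<open>2 * 3 + 9 * 2 = 24\<close>, and \<open>v\<close> still moves
  at most 10 times, which leaves room for a common final phase. If no such configuration exists, then
  letting each vertex of larger degree send \<open>1/5\<close> to each neighbour of degree 3 shows that the average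
  degree is at least \<open>17/5\<close>.

  For plane graphs of girth at least 5 it suffices that \<open>3|E| \<le> 5|V|\<close>. By the Jordan curve theorem,
  deleting an edge of a cycle reduces the number \<open>f\<close> of faces, so \<open>|E| \<le> |V| + f\<close>. By Janiszewski's
  theorem an edge of a cycle lies on at most two faces, and the edges on a face contain a cycle
  unless the graph is a forest; hence \<open>5f \<le> 2|E|\<close>.\<close>

section \<open>Extending recolouring sequences\<close>

text \<open>The bound 12 is shared by two phases: the extended sequence leaves the new vertices in
  colours beyond control, and \<open>finish\<close> corrects them at a cost of 1, 2 or 3 moves,
  according to the role of the vertex. The obstacle is a vertex \<open>w\<close> of degree 3 next to
  the hub: besides the colours of \<open>w\<close>, of the hub and of two outer neighbours, a list
  of 6 has just two spare colours, so that \<open>w\<close> might have to move at every second of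
  its 24 events. These 12 moves exceed by one what \<open>finish\<close> leaves; giving way lets
  \<open>w\<close> use the hub's colour as a third candidate. For a \<open>w\<close> adjacent to
  another one, the hub's moves count as events too; such vertices are inserted later, and in their
  presence the hub may move at most 4 times. The bound 17/5 is where the discharging balances: 3 +
  2/5 = 4 - 3/5. For plane graphs 5/3 < 17/10 leaves slack, which is why Euler's formula is used
  without its additive constant.\<close>

locale list_graph =
  fixes E :: "'a set set" and L :: "'a \<Rightarrow> 'c set"
  assumes loopless: "{v} \<notin> E"
begin

definition nbrs :: "'a \<Rightarrow> 'a set \<Rightarrow> 'a set" where
  "nbrs v U = {u \<in> U. {u, v} \<in> E}"

definition proper :: "'a set \<Rightarrow> ('a \<Rightarrow> 'c) \<Rightarrow> bool" where
  "proper U \<phi> \<longleftrightarrow> (\<forall>u\<in>U. \<phi> u \<in> L u) \<and> (\<forall>u\<in>U. \<forall>v\<in>U. {u, v} \<in> E \<longrightarrow> \<phi> u \<noteq> \<phi> v)"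

fun run :: "('a \<Rightarrow> 'c) \<Rightarrow> ('a \<times> 'c) list \<Rightarrow> 'a \<Rightarrow> 'c" where
  "run \<phi> [] = \<phi>"
| "run \<phi> ((v, c) # ms) = run (\<phi>(v := c)) ms"

fun valid :: "'a set \<Rightarrow> ('a \<Rightarrow> 'c) \<Rightarrow> ('a \<times> 'c) list \<Rightarrow> bool" where
  "valid U \<phi> [] \<longleftrightarrow> proper U \<phi>"
| "valid U \<phi> ((v, c) # ms) \<longleftrightarrow> proper U \<phi> \<and> v \<in> U \<and> valid U (\<phi>(v := c)) ms"

definition moves :: "'a \<Rightarrow> ('a \<times> 'c) list \<Rightarrow> nat" where
  "moves v ms = length (filter (\<lambda>m. fst m = v) ms)"

text \<open>These are the events at \<open>w\<close>. A colour of \<open>w\<close> survives the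
  first \<open>n\<close> of them without a move of \<open>w\<close> if it avoids
  \<open>take n\<close> of this list.\<close>

definition nbr_colors :: "'a \<Rightarrow> ('a \<times> 'c) list \<Rightarrow> 'c list" where
  "nbr_colors w ms = map snd (filter (\<lambda>m. {fst m, w} \<in> E) ms)"

text \<open>\<open>moves_in U ns = ms\<close> expresses that \<open>ns\<close> extends
  \<open>ms\<close>: the vertices of \<open>U\<close> move exactly as before.\<close>

definition moves_in :: "'a set \<Rightarrow> ('a \<times> 'c) list \<Rightarrow> ('a \<times> 'c) list" where
  "moves_in U ms = filter (\<lambda>m. fst m \<in> U) ms"

lemma moves_simps [simp]:
  "moves v [] = 0"
  "moves v ((u, c) # ms) = (if u = v then Suc (moves v ms) else moves v ms)"
  "moves v (ms @ ns) = moves v ms + moves v ns"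
  by (auto simp: moves_def)

lemma nbr_colors_simps [simp]:
  "nbr_colors v [] = []"
  "nbr_colors v ((u, c) # ms) = (if {u, v} \<in> E then c # nbr_colors v ms else nbr_colors v ms)"
  by (auto simp: nbr_colors_def)

lemma moves_in_simps [simp]:
  "moves_in U [] = []"
  "moves_in U ((u, c) # ms) = (if u \<in> U then (u, c) # moves_in U ms else moves_in U ms)"
  "moves_in U (ms @ ns) = moves_in U ms @ moves_in U ns"
  by (auto simp: moves_in_def)

lemma moves_in_idem: "U \<subseteq> T \<Longrightarrow> moves_in U (moves_in T ms) = moves_in U ms"
  by (induction ms) auto

lemma moves_moves_in: "u \<in> U \<Longrightarrow> moves u (moves_in U ms) = moves u ms"
  by (induction ms) auto

lemma finite_nbrs: "finite U \<Longrightarrow> finite (nbrs v U)"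
  by (auto simp: nbrs_def)

lemma not_in_nbrs: "v \<notin> nbrs v U"
  using loopless by (auto simp: nbrs_def)

lemma nbrs_sym: "u \<in> nbrs v U \<Longrightarrow> v \<in> T \<Longrightarrow> v \<in> nbrs u T"
  by (auto simp: nbrs_def insert_commute)

lemma proper_mono: "proper T \<phi> \<Longrightarrow> U \<subseteq> T \<Longrightarrow> proper U \<phi>"
  by (auto simp: proper_def)

lemma proper_cong: "(\<And>u. u \<in> U \<Longrightarrow> \<phi> u = \<psi> u) \<Longrightarrow> proper U \<phi> = proper U \<psi>"
  by (auto simp: proper_def)

lemma proper_update:
  assumes "proper T \<phi>" "c \<in> L x" "c \<notin> \<phi> ` nbrs x T"
  shows "proper T (\<phi>(x := c))"
  using assms loopless[of x] by (auto simp: proper_def nbrs_def insert_commute image_iff)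

lemma proper_nbr_neq: "proper T \<phi> \<Longrightarrow> x \<in> T \<Longrightarrow> u \<in> nbrs x T \<Longrightarrow> \<phi> u \<noteq> \<phi> x"
  by (auto simp: proper_def nbrs_def)

lemma valid_proper: "valid U \<phi> ms \<Longrightarrow> proper U \<phi>"
  by (cases ms) auto

lemma valid_append: "valid U \<phi> (ms @ ns) \<longleftrightarrow> valid U \<phi> ms \<and> valid U (run \<phi> ms) ns"
  by (induction U \<phi> ms rule: valid.induct) (auto simp del: fun_upd_apply dest: valid_proper)

lemma run_append: "run \<phi> (ms @ ns) = run (run \<phi> ms) ns"
  by (induction \<phi> ms rule: run.induct) (auto simp del: fun_upd_apply)

lemma valid_run: "valid U \<phi> ms \<Longrightarrow> proper U (run \<phi> ms)"
  by (induction U \<phi> ms rule: valid.induct) (auto simp del: fun_upd_apply)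

lemma fst_valid_subset: "valid U \<phi> ms \<Longrightarrow> fst ` set ms \<subseteq> U"
  by (induction U \<phi> ms rule: valid.induct) (auto simp del: fun_upd_apply)

lemma valid_cong:
  "(\<And>u. u \<in> U \<Longrightarrow> \<phi> u = \<psi> u) \<Longrightarrow> valid U \<phi> ms = valid U \<psi> ms"
proof (induction ms arbitrary: \<phi> \<psi>)
  case Nil
  then have "proper U \<phi> = proper U \<psi>" by (intro proper_cong) auto
  then show ?case by simp
next
  case (Cons m ms)
  obtain v c where m: "m = (v, c)" by force
  have "valid U (\<phi>(v := c)) ms = valid U (\<psi>(v := c)) ms"
    by (rule Cons.IH) (use Cons.prems in auto)
  moreover have "proper U \<phi> = proper U \<psi>" by (rule proper_cong) (use Cons.prems in auto)
  ultimately show ?case by (simp add: m)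
qed

text \<open>Guarantees that an extended sequence still ends in the target colours on the vertices
  treated before.\<close>

lemma run_moves_in: "u \<in> U \<Longrightarrow> \<phi> u = \<psi> u \<Longrightarrow> run \<phi> ms u = run \<psi> (moves_in U ms) u"
proof (induction ms arbitrary: \<phi> \<psi>)
  case (Cons m ms)
  obtain x c where m: "m = (x, c)" by force
  have "run (\<phi>(x := c)) ms u = run (if x \<in> U then \<psi>(x := c) else \<psi>) (moves_in U ms) u"
    by (rule Cons.IH) (use Cons.prems in auto)
  then show ?case by (auto simp: m simp del: fun_upd_apply)
qed auto

lemma run_outside: "u \<notin> fst ` set ms \<Longrightarrow> run \<phi> ms u = \<phi> u"
  by (induction \<phi> ms rule: run.induct) auto

lemma length_nbr_colors:
  assumes "finite U" "fst ` set ms \<subseteq> U"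
  shows "length (nbr_colors w ms) = (\<Sum>u\<in>nbrs w U. moves u ms)"
  using assms(2)
proof (induction ms)
  case (Cons m ms)
  obtain x c where m: "m = (x, c)" by force
  have "(\<Sum>u\<in>nbrs w U. moves u (m # ms))
      = (\<Sum>u\<in>nbrs w U. moves u ms + (if u = x then 1 else 0))"
    by (rule sum.cong) (auto simp: m)
  also have "\<dots> = (\<Sum>u\<in>nbrs w U. moves u ms) + (if x \<in> nbrs w U then 1 else 0)"
    using finite_nbrs[OF assms(1)] by (simp add: sum.distrib)
  finally show ?case using Cons by (auto simp: m nbrs_def)
qed auto

lemma nbr_colors_moves_in:
  assumes "\<And>m. m \<in> set ms \<Longrightarrow> {fst m, w} \<in> E \<Longrightarrow> fst m \<in> U"
  shows "nbr_colors w ms = nbr_colors w (moves_in U ms)"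
  using assms by (induction ms) fastforce+

section \<open>Choice of the colour that lasts longest, and the extension to a hub with its
  leaves\<close>

lemma pick_color:
  assumes "n < card X" shows "\<exists>c\<in>X. c \<notin> set (take n xs)"
proof (rule ccontr)
  assume "\<not> ?thesis"
  then have "X \<subseteq> set (take n xs)" by auto
  then have "card X \<le> card (set (take n xs))" by (rule card_mono[rotated]) simp
  also have "\<dots> \<le> n" using card_length[of "take n xs"] by simp
  finally show False using assms by simp
qed

text \<open>The imminent colour \<open>c\<close> is no candidate and so excludes none; hence
  \<open>n\<close> candidates suffice to survive \<open>n\<close> events, where
  \<open>pick_color\<close> needs one more.\<close>

lemma pick_color_hit:
  assumes "n \<le> card X" "0 < n" "c \<notin> X" shows "\<exists>d\<in>X. d \<notin> set (take n (c # xs))"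
proof -
  have "n - 1 < card X" using assms by simp
  from pick_color[OF this, of xs] obtain d where "d \<in> X" "d \<notin> set (take (n - 1) xs)" by auto
  then show ?thesis using assms by (cases n) auto
qed

text \<open>When a neighbour outside \<open>S\<close> is about to take the colour of \<open>w \<in> W\<close>, then \<open>w\<close> moves to the
  colour that stays unused longest. As long as \<open>h w > 0\<close> the hub \<open>v\<close> gives way if it has this colour,
  so the next two such events at \<open>w\<close> are harmless, otherwise only the next one. The numbers \<open>q w\<close> and
  \<open>r\<close> count the coming events already known to be harmless for \<open>w\<close> and \<open>v\<close>.\<close>

lemma hub_extension_aux:
  assumes fin: "finite U" "finite W" and disj: "v \<notin> U" "W \<inter> U = {}" "v \<notin> W"
    and adj: "\<And>w. w \<in> W \<Longrightarrow> {w, v} \<in> E"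
    and indep: "\<And>w x. w \<in> W \<Longrightarrow> x \<in> W \<Longrightarrow> {w, x} \<notin> E"
    and finL: "\<And>w. w \<in> W \<Longrightarrow> finite (L w)" "finite (L v)"
    and LW: "\<And>w. w \<in> W \<Longrightarrow> card (nbrs w U) + 4 \<le> card (L w)"
    and Lv: "card (nbrs v U) + card W + 1 + \<rho> \<le> card (L v)" and \<rho>: "1 \<le> \<rho>"
  shows "proper (U \<union> insert v W) \<phi> \<Longrightarrow> valid U \<phi> ms \<Longrightarrow>
    (\<forall>w\<in>W. \<phi> w \<notin> set (take (q w) (nbr_colors w ms)) \<and>
       length (nbr_colors w ms) \<le> q w + 2 * m w + min (h w) (m w)) \<Longrightarrow>
    \<phi> v \<notin> set (take r (nbr_colors v ms)) \<Longrightarrow> r \<le> \<rho> - 1 \<Longrightarrow> length (nbr_colors v ms) \<le> r + \<rho> * n \<Longrightarrow>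
    \<exists>ns. valid (U \<union> insert v W) \<phi> ns \<and> moves_in U ns = ms \<and> (\<forall>w\<in>W. moves w ns \<le> m w) \<and>
      moves v ns \<le> n + sum h W"
\<comment> \<open>A move of some \<open>w\<close> leaves \<open>ms\<close> unchanged and lowers
  \<open>m w\<close>; the same event is then examined again, until no vertex of \<open>W\<close> has
  its colour. Keeping \<open>r \<le> \<rho> - 1\<close> matters: a voluntary move of
  \<open>v\<close> secures \<open>\<rho> - 1\<close> events, so it never loses any and
  \<open>n\<close> need not grow.\<close>
proof (induction "length ms + sum m W + n" arbitrary: \<phi> ms q m h r n rule: less_induct)
  case less
  let ?T = "U \<union> insert v W"
  show ?case
  proof (cases ms)
    case Nil
    then show ?thesis using less.prems by (intro exI[of _ "[]"]) auto
  next
    case (Cons mv ms1)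
    obtain y c where ms: "ms = (y, c) # ms1" using Cons by (cases mv) auto
    have yU: "y \<in> U" using less.prems(2) ms by simp
    \<comment> \<open>\<open>tail\<close> carries out the event itself once \<open>c\<close> has
      been vacated around \<open>y\<close>. A forced move of \<open>v\<close> secures
      \<open>\<rho>\<close> events, but the present one is among them and only
      \<open>\<rho> - 1\<close> remain afterwards; hence the disjunction.\<close>
    have tail: "\<exists>ns. valid ?T \<psi> ns \<and> moves_in U ns = ms \<and> (\<forall>w\<in>W. moves w ns \<le> m w) \<and>
        moves v ns \<le> n' + sum h W"
      if 1: "proper ?T \<psi>" "\<And>u. u \<noteq> v \<Longrightarrow> \<psi> u = \<phi> u"
        and 2: "\<psi> v \<notin> set (take r' (nbr_colors v ms))" "length (nbr_colors v ms) \<le> r' + \<rho> * n'"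
          "r' \<le> \<rho> - 1 \<or> {y, v} \<in> E \<and> r' \<le> \<rho>" "n' \<le> n"
        and 3: "\<And>w. w \<in> insert v W \<Longrightarrow> {y, w} \<in> E \<Longrightarrow> \<psi> w \<noteq> c"
      for \<psi> r' n'
    proof -
      have nb: "\<psi> u \<noteq> c" if "u \<in> nbrs y ?T" for u
      proof (cases "u \<in> U")
        case True
        have "proper U (\<phi>(y := c))" using less.prems(2) ms valid_proper by auto
        then have "\<phi> u \<noteq> c" using that True yU loopless[of y] unfolding proper_def nbrs_def
          by (metis (mono_tags, lifting) fun_upd_apply insert_absorb2 mem_Collect_eq)
        moreover have "\<psi> u = \<phi> u" using 1(2)[of u] True disj by blast
        ultimately show ?thesis by simp
      next
        case False
        then show ?thesis using that 3[of u] by (auto simp: nbrs_def insert_commute)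
      qed
      have "c \<in> L y" using less.prems(2) ms valid_proper[of U "\<phi>(y := c)" ms1] yU
        by (auto simp: proper_def)
      then have pr: "proper ?T (\<psi>(y := c))" using nb by (intro proper_update 1) auto
      define q' where "q' w = (if {y, w} \<in> E then q w - 1 else q w)" for w
      define r'' where "r'' = (if {y, v} \<in> E then r' - 1 else r')"
      have vne: "y \<noteq> v" using yU disj by auto
      have "\<exists>ns. valid ?T (\<psi>(y := c)) ns \<and> moves_in U ns = ms1 \<and> (\<forall>w\<in>W. moves w ns \<le> m w) \<and>
          moves v ns \<le> n' + sum h W"
      proof (rule less.hyps[where q = q' and r = r''])
        show "length ms1 + sum m W + n' < length ms + sum m W + n" using 2(4) ms by simp
        show "valid U (\<psi>(y := c)) ms1"
        proof -
          have "valid U (\<psi>(y := c)) ms1 = valid U (\<phi>(y := c)) ms1"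
            by (rule valid_cong) (metis 1(2) disj(1) fun_upd_apply)
          then show ?thesis using less.prems(2) ms by simp
        qed
        show "\<forall>w\<in>W. (\<psi>(y := c)) w \<notin> set (take (q' w) (nbr_colors w ms1)) \<and>
            length (nbr_colors w ms1) \<le> q' w + 2 * m w + min (h w) (m w)"
        proof
          fix w assume w: "w \<in> W"
          have [simp]: "w \<noteq> y" "w \<noteq> v" using w yU disj by auto
          have a: "\<phi> w \<notin> set (take (q w) (nbr_colors w ms))" "length (nbr_colors w ms) \<le> q w + 2 * m w + min (h w) (m w)"
            using less.prems(3) w by auto
          have "\<phi> w \<notin> set (take (q' w) (nbr_colors w ms1))" using a(1) unfolding ms q'_def
            by (cases "q w") (auto split: if_splits)
          moreover have "length (nbr_colors w ms1) \<le> q' w + 2 * m w + min (h w) (m w)"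
            using a(2) unfolding ms q'_def by (auto split: if_splits)
          ultimately show "(\<psi>(y := c)) w \<notin> set (take (q' w) (nbr_colors w ms1)) \<and>
            length (nbr_colors w ms1) \<le> q' w + 2 * m w + min (h w) (m w)" using 1(2)[of w] by simp
        qed
        show "(\<psi>(y := c)) v \<notin> set (take r'' (nbr_colors v ms1))" using 2(1) vne unfolding ms r''_def
          by (cases r') (auto split: if_splits)
        show "r'' \<le> \<rho> - 1" using 2(3) unfolding r''_def by auto
        show "length (nbr_colors v ms1) \<le> r'' + \<rho> * n'" using 2(2) unfolding ms r''_def
          by (auto split: if_splits)
      qed (use pr in auto)
      then obtain ns where "valid ?T (\<psi>(y := c)) ns" "moves_in U ns = ms1" "\<forall>w\<in>W. moves w ns \<le> m w"
        "moves v ns \<le> n' + sum h W" by blast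
      then show ?thesis using 1 yU ms disj by (intro exI[of _ "(y, c) # ns"]) auto
    qed
    show ?thesis
    proof (cases "\<exists>w\<in>W. {y, w} \<in> E \<and> \<phi> w = c")
      case True
      then obtain w where w: "w \<in> W" "{y, w} \<in> E" "\<phi> w = c" by auto
      have wU: "w \<notin> U" "w \<noteq> v" using w disj by auto
      have nw: "nbrs w ?T = insert v (nbrs w U)"
        using adj[OF w(1)] indep[OF w(1)] by (auto simp: nbrs_def insert_commute)
      have evw: "nbr_colors w ms = c # nbr_colors w ms1" using w ms by simp
      have bw: "\<phi> w \<notin> set (take (q w) (nbr_colors w ms))"
        "length (nbr_colors w ms) \<le> q w + 2 * m w + min (h w) (m w)"
        using less.prems(3) w by auto
      have qw: "q w = 0" using bw(1) w(3) evw by (cases "q w") auto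
      have mw: "1 \<le> m w" using bw(2) qw evw by (cases "m w") auto
      \<comment> \<open>By \<open>LW\<close>, at least 3 colours remain besides those of
        \<open>w\<close> and of its neighbours in \<open>U\<close>, and at least 2 if the colour of
        \<open>v\<close> is excluded as well. The present event counts among the \<open>k\<close>,
        so 2 or 1 later ones become harmless.\<close>
      define k where "k = (if h w = 0 then 2 else 3 :: nat)"
      define X where "X = L w - \<phi> ` nbrs w U - {\<phi> w} - (if h w = 0 then {\<phi> v} else {})"
      have "card (L w) \<le> card (X \<union> (\<phi> ` nbrs w U \<union> {\<phi> w} \<union> (if h w = 0 then {\<phi> v} else {})))"
        by (rule card_mono) (use finL w fin finite_nbrs X_def in auto)
      also have "\<dots> \<le> card X + (card (\<phi> ` nbrs w U) + card {\<phi> w} +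
          card (if h w = 0 then {\<phi> v} else {}))"
        by (meson card_Un_le add_mono le_refl order_trans)
      also have "\<dots> \<le> card X + (card (nbrs w U) + 1 + (if h w = 0 then 1 else 0))"
        using card_image_le[OF finite_nbrs[OF fin(1)], of \<phi> w] by auto
      finally have cX: "k \<le> card X" using LW[OF w(1)] by (auto simp: k_def split: if_splits)
      have "c \<notin> X" using w X_def by auto
      moreover have "0 < k" by (simp add: k_def)
      ultimately obtain d where d: "d \<in> X" "d \<notin> set (take k (nbr_colors w ms))"
        using pick_color_hit[OF cX, of c "nbr_colors w ms1"] unfolding evw by blast
      define m' where "m' = m(w := m w - 1)"
      \<comment> \<open>A unit of \<open>h w\<close> is spent even if \<open>v\<close> need not give
        way: the term \<open>min (h w) (m w)\<close> counts the moves that cope with three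
        events.\<close>
      define h' where "h' = h(w := h w - 1)"
      define q' where "q' = q(w := k)"
      have sm: "sum m' W < sum m W" unfolding m'_def
        using mw w fin by (auto intro!: sum_strict_mono_ex1 bexI[of _ w])
      have sh: "sum h' W \<le> sum h W" unfolding h'_def by (auto intro!: sum_mono)
      have sh1: "sum h' W < sum h W" if "h w \<noteq> 0" unfolding h'_def
        using that w fin by (auto intro!: sum_strict_mono_ex1 bexI[of _ w])
      have cnt: "length (nbr_colors x ms) \<le> q' x + 2 * m' x + min (h' x) (m' x)" if "x \<in> W" for x
      proof (cases "x = w")
        case True
        then show ?thesis using bw(2) qw mw unfolding q'_def m'_def h'_def k_def
          by (cases "h w"; cases "m w"; auto simp: min_def)
      next
        case False
        then show ?thesis using less.prems(3) that unfolding q'_def m'_def h'_def by auto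
      qed
      have dX: "d \<in> L w" "d \<notin> \<phi> ` nbrs w U" using d X_def by auto
      have IH: "\<exists>ns. valid ?T \<psi> ns \<and> moves_in U ns = ms \<and> (\<forall>x\<in>W. moves x ns \<le> m' x) \<and>
          moves v ns \<le> n + sum h' W"
        if 1: "proper ?T \<psi>" "\<And>u. u \<noteq> v \<Longrightarrow> u \<noteq> w \<Longrightarrow> \<psi> u = \<phi> u" "\<psi> w = d"
          and 2: "\<psi> v \<notin> set (take r' (nbr_colors v ms))" "r \<le> r'" "r' \<le> \<rho> - 1"
        for \<psi> r'
      proof (rule less.hyps[where q = q' and r = r'])
        show "length ms + sum m' W + n < length ms + sum m W + n" using sm by simp
        show "valid U \<psi> ms" using less.prems(2) valid_cong[of U \<psi> \<phi> ms] 1(2) wU disj by metis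
        show "\<forall>x\<in>W. \<psi> x \<notin> set (take (q' x) (nbr_colors x ms)) \<and>
           length (nbr_colors x ms) \<le> q' x + 2 * m' x + min (h' x) (m' x)"
        proof
          fix x assume x: "x \<in> W"
          have "x \<noteq> v" using x disj by auto
          then have "\<psi> x \<notin> set (take (q' x) (nbr_colors x ms))"
            using less.prems(3) x d(2) 1(2)[of x] 1(3) by (cases "x = w") (auto simp: q'_def)
          then show "\<psi> x \<notin> set (take (q' x) (nbr_colors x ms)) \<and>
           length (nbr_colors x ms) \<le> q' x + 2 * m' x + min (h' x) (m' x)" using cnt x by blast
        qed
        show "length (nbr_colors v ms) \<le> r' + \<rho> * n" using less.prems(6) 2 by linarith
      qed (use that in auto)
      have fin_moves: "moves x ((w, d) # ns) \<le> m x" if "x \<in> W" "\<forall>x\<in>W. moves x ns \<le> m' x" for x ns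
      proof -
        have "moves x ns \<le> m' x" using that by auto
        then show ?thesis using mw unfolding m'_def by (auto split: if_splits)
      qed
      show ?thesis
      proof (cases "d = \<phi> v")
        case False
        have "proper ?T (\<phi>(w := d))"
          by (rule proper_update) (use less.prems(1) dX False nw in auto)
        from IH[OF this, of r] less.prems(4,5) wU
        obtain ns where ns: "valid ?T (\<phi>(w := d)) ns" "moves_in U ns = ms" "\<forall>x\<in>W. moves x ns \<le> m' x"
          "moves v ns \<le> n + sum h' W" by auto
        then show ?thesis using wU w less.prems(1) sh fin_moves[OF _ ns(3)]
          by (intro exI[of _ "(w, d) # ns"]) auto
      next
        case True
        have hw: "h w \<noteq> 0" using True d X_def by auto
        \<comment> \<open>The hub avoids the colours of \<open>W\<close>, so no leaf has to react.
          The next event at \<open>v\<close> may take a colour of \<open>Y\<close>, so one of the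
          \<open>\<rho>\<close> guaranteed candidates is lost and only \<open>\<rho> - 1\<close>
          events are secured. The move is paid for by the unit taken from
          \<open>h w\<close>.\<close>
        define Y where "Y = L v - \<phi> ` nbrs v U - \<phi> ` W - {\<phi> v}"
        have "card (L v) \<le> card (Y \<union> (\<phi> ` nbrs v U \<union> \<phi> ` W \<union> {\<phi> v}))"
          by (rule card_mono) (use finL fin finite_nbrs Y_def in auto)
        also have "\<dots> \<le> card Y + (card (\<phi> ` nbrs v U) + card (\<phi> ` W) + card {\<phi> v})"
          by (meson card_Un_le add_mono le_refl order_trans)
        also have "\<dots> \<le> card Y + (card (nbrs v U) + card W + 1)"
          using card_image_le[OF finite_nbrs[OF fin(1)], of \<phi> v] card_image_le[OF fin(2), of \<phi>]
          by auto
        finally have "\<rho> - 1 < card Y" using Lv \<rho> by auto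
        from pick_color[OF this, of "nbr_colors v ms"]
        obtain e where e: "e \<in> Y" "e \<notin> set (take (\<rho> - 1) (nbr_colors v ms))" by blast
        have p1: "proper ?T (\<phi>(v := e))"
          by (rule proper_update) (use less.prems(1) e Y_def loopless[of v] in \<open>auto simp: nbrs_def\<close>)
        have p2: "proper ?T (\<phi>(v := e, w := d))"
          by (rule proper_update) (use p1 dX True nw e Y_def disj in \<open>auto simp: nbrs_def\<close>)
        from IH[OF p2, of "\<rho> - 1"] e less.prems(5) wU
        obtain ns where ns: "valid ?T (\<phi>(v := e, w := d)) ns" "moves_in U ns = ms"
          "\<forall>x\<in>W. moves x ns \<le> m' x" "moves v ns \<le> n + sum h' W" by auto
        have "moves x ((v, e) # (w, d) # ns) \<le> m x" if "x \<in> W" for x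
          using fin_moves[OF that ns(3)] that disj by auto
        then show ?thesis using wU w less.prems(1) sh1[OF hw] ns p1 disj
          by (intro exI[of _ "(v, e) # (w, d) # ns"]) auto
      qed
    next
      case nohit: False
      show ?thesis
      proof (cases "{y, v} \<in> E \<and> \<phi> v = c")
        case False
        show ?thesis
          by (rule tail[of \<phi> r n]) (use less.prems nohit False in auto)
      next
        case True
        define X where "X = L v - \<phi> ` nbrs v U - \<phi> ` W - {\<phi> v}"
        have "card (L v) \<le> card (X \<union> (\<phi> ` nbrs v U \<union> \<phi> ` W \<union> {\<phi> v}))"
          by (rule card_mono) (use finL fin finite_nbrs X_def in auto)
        also have "\<dots> \<le> card X + (card (\<phi> ` nbrs v U) + card (\<phi> ` W) + card {\<phi> v})"
          by (meson card_Un_le add_mono le_refl order_trans)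
        also have "\<dots> \<le> card X + (card (nbrs v U) + card W + 1)"
          using card_image_le[OF finite_nbrs[OF fin(1)], of \<phi> v] card_image_le[OF fin(2), of \<phi>]
          by auto
        finally have cX: "\<rho> \<le> card X" using Lv by auto
        have "c \<notin> X" using True X_def by auto
        from pick_color_hit[OF cX _ this, of "nbr_colors v ms1"] \<rho> True
        obtain d where d: "d \<in> X" "d \<notin> set (take \<rho> (nbr_colors v ms))" unfolding ms by auto
        have p: "proper ?T (\<phi>(v := d))"
          by (rule proper_update) (use less.prems(1) d X_def loopless[of v] in \<open>auto simp: nbrs_def\<close>)
        \<comment> \<open>The colour of \<open>v\<close> is hit right now, so no harmless event is
          left; this is the moment to charge one unit of \<open>n\<close>, which covers the next
          \<open>\<rho>\<close> events.\<close>
        have r0: "r = 0" using less.prems(4) True ms by (cases r) auto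
        have n0: "1 \<le> n" using less.prems(6) True ms r0 by (cases n) auto
        have "\<exists>ns. valid ?T (\<phi>(v := d)) ns \<and> moves_in U ns = ms \<and> (\<forall>w\<in>W. moves w ns \<le> m w) \<and>
            moves v ns \<le> (n - 1) + sum h W"
        proof (rule tail[of _ \<rho>])
          show "length (nbr_colors v ms) \<le> \<rho> + \<rho> * (n - 1)" using less.prems(6) r0 n0
            by (cases n) auto
          show "(\<phi>(v := d)) w \<noteq> c" if "w \<in> insert v W" "{y, w} \<in> E" for w
            using that nohit d X_def True by auto
        qed (use p d True in auto)
        then obtain ns where "valid ?T (\<phi>(v := d)) ns" "moves_in U ns = ms" "\<forall>w\<in>W. moves w ns \<le> m w"
            "moves v ns \<le> (n - 1) + sum h W" by blast
        then show ?thesis using less.prems(1) n0 disj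
          by (intro exI[of _ "(v, d) # ns"]) auto
      qed
    qed
  qed
qed

lemma hub_extension:
  assumes fin: "finite U" "finite W" and disj: "v \<notin> U" "W \<inter> U = {}" "v \<notin> W"
    and adj: "\<And>w. w \<in> W \<Longrightarrow> {w, v} \<in> E"
    and indep: "\<And>w x. w \<in> W \<Longrightarrow> x \<in> W \<Longrightarrow> {w, x} \<notin> E"
    and finL: "\<And>w. w \<in> W \<Longrightarrow> finite (L w)" "finite (L v)"
    and LW: "\<And>w. w \<in> W \<Longrightarrow> card (nbrs w U) + 4 \<le> card (L w)"
    and Lv: "card (nbrs v U) + card W + 1 + \<rho> \<le> card (L v)" and \<rho>: "1 \<le> \<rho>"
    and \<phi>: "proper (U \<union> insert v W) \<phi>" and ms: "valid U \<phi> ms"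
    and evW: "\<And>w. w \<in> W \<Longrightarrow> length (nbr_colors w ms) \<le> 2 * m w + min (h w) (m w)"
    and evv: "length (nbr_colors v ms) \<le> \<rho> * n"
  obtains ns where "valid (U \<union> insert v W) \<phi> ns" "moves_in U ns = ms"
    "\<And>w. w \<in> W \<Longrightarrow> moves w ns \<le> m w" "moves v ns \<le> n + sum h W"
  using hub_extension_aux[of U W v \<rho> \<phi> ms "\<lambda>_. 0" m h 0 n] assms by (auto simp: that)

text \<open>The vertices of \<open>T\<close> are inserted one by one, each as a hub without leaves.
  By independence they cause no events at each other, so each of them faces just the events of
  \<open>ms\<close>.\<close>

lemma key_extension:
  assumes "finite U" "finite T" "T \<inter> U = {}"
    and indep: "\<And>t x. t \<in> T \<Longrightarrow> x \<in> T \<Longrightarrow> {t, x} \<notin> E"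
    and L: "\<And>t. t \<in> T \<Longrightarrow> finite (L t) \<and> card (nbrs t U) + 1 + \<rho> \<le> card (L t)" and \<rho>: "1 \<le> \<rho>"
    and \<phi>: "proper (U \<union> T) \<phi>" and ms: "valid U \<phi> ms"
    and nbr_colors: "\<And>t. t \<in> T \<Longrightarrow> length (nbr_colors t ms) \<le> \<rho> * n"
  obtains ns where "valid (U \<union> T) \<phi> ns" "moves_in U ns = ms" "\<And>t. t \<in> T \<Longrightarrow> moves t ns \<le> n"
proof -
  have "\<exists>ns. valid (U \<union> T) \<phi> ns \<and> moves_in U ns = ms \<and> (\<forall>t\<in>T. moves t ns \<le> n)"
    using assms(2,3) indep L \<phi> nbr_colors
  proof (induction T rule: finite_induct)
    case empty
    have "moves_in U ms = ms" using fst_valid_subset[OF ms] by (induction ms) auto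
    then show ?case using ms by auto
  next
    case (insert t T)
    have "\<exists>ns. valid (U \<union> T) \<phi> ns \<and> moves_in U ns = ms \<and> (\<forall>t\<in>T. moves t ns \<le> n)"
      by (rule insert.IH) (use insert.prems in \<open>auto intro: proper_mono\<close>)
    then obtain ns where ns: "valid (U \<union> T) \<phi> ns" "moves_in U ns = ms" "\<forall>t\<in>T. moves t ns \<le> n"
      by blast
    have nb: "nbrs t (U \<union> T) = nbrs t U" using insert.prems(2) by (auto simp: nbrs_def)
    have "nbr_colors t ns = nbr_colors t (moves_in U ns)"
      by (rule nbr_colors_moves_in) (use fst_valid_subset[OF ns(1)] insert.prems(2) in fastforce)
    then have evt: "length (nbr_colors t ns) \<le> \<rho> * n" using insert.prems(5) ns(2) by auto
    obtain ns' where ns': "valid (U \<union> T \<union> insert t {}) \<phi> ns'" "moves_in (U \<union> T) ns' = ns"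
      "moves t ns' \<le> n + sum (\<lambda>_. 0) {}"
      by (rule hub_extension[of "U \<union> T" "{}" t \<rho> \<phi> ns "\<lambda>_. 0" "\<lambda>_. 0" n])
        (use insert assms(1) \<rho> nb ns evt in auto)
    have "moves x ns' \<le> n" if "x \<in> T" for x
      using moves_moves_in[of x "U \<union> T" ns'] ns'(2) ns(3) that by auto
    then show ?case using ns' ns(2) moves_in_idem[of U "U \<union> T" ns'] by (intro exI[of _ ns']) auto
  qed
  then show ?thesis using that by blast
qed

section \<open>The final phase: reaching the target colours\<close>

lemma move_set:
  assumes "finite T" "T \<subseteq> U" and \<phi>: "proper U \<phi>"
    and indep: "\<And>t x. t \<in> T \<Longrightarrow> x \<in> T \<Longrightarrow> {t, x} \<notin> E"
    and \<tau>: "\<And>t. t \<in> T \<Longrightarrow> \<tau> t \<in> L t" "\<And>t u. t \<in> T \<Longrightarrow> u \<in> nbrs t U \<Longrightarrow> \<phi> u \<noteq> \<tau> t"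
  obtains ns where "valid U \<phi> ns" "run \<phi> ns = (\<lambda>u. if u \<in> T then \<tau> u else \<phi> u)"
    "\<And>u. moves u ns = (if u \<in> T then 1 else 0)"
proof -
  have "\<exists>ns. valid U \<phi> ns \<and> run \<phi> ns = (\<lambda>u. if u \<in> T then \<tau> u else \<phi> u) \<and>
    (\<forall>u. moves u ns = (if u \<in> T then 1 else 0))"
    using assms(1,2) indep \<tau>
  proof (induction T rule: finite_induct)
    case empty
    then show ?case using \<phi> by (intro exI[of _ "[]"]) auto
  next
    case (insert t T)
    then obtain ns where ns: "valid U \<phi> ns" "run \<phi> ns = (\<lambda>u. if u \<in> T then \<tau> u else \<phi> u)"
      "\<forall>u. moves u ns = (if u \<in> T then 1 else 0)" by auto
    have "proper U ((run \<phi> ns)(t := \<tau> t))"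
    proof (rule proper_update)
      have "run \<phi> ns u = \<phi> u" if "u \<in> nbrs t U" for u
        using that insert.prems(2)[of t u] ns(2) by (auto simp: nbrs_def insert_commute)
      then show "\<tau> t \<notin> run \<phi> ns ` nbrs t U" using insert.prems(4)[of t] by force
    qed (use insert.prems valid_run[OF ns(1)] in auto)
    then show ?case using ns insert.hyps insert.prems(1) valid_run[OF ns(1)]
      by (intro exI[of _ "ns @ [(t, \<tau> t)]"]) (auto simp: valid_append run_append)
  qed
  then show ?thesis using that by blast
qed

lemma avoid_colors:
  assumes "finite (L x)" "finite X" "card X < card (L x)"
  shows "\<exists>c. c \<in> L x \<and> c \<notin> X"
  using assms by (metis card_mono leD subsetI)

text \<open>Once \<open>U - insert v (A \<union> D)\<close> carries its target colouring, first \<open>A\<close> clears the target colours of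
  \<open>D\<close>; then \<open>D\<close> moves to its target colours, those vertices that want the present colour of \<open>v\<close> after
  \<open>v\<close> has left it.\<close>

lemma finish:
  assumes fin: "finite U" and sub: "v \<in> U" "A \<subseteq> U" "D \<subseteq> U"
    and disj: "v \<notin> A" "v \<notin> D" "A \<inter> D = {}"
    and indep: "\<And>t x. t \<in> A \<Longrightarrow> x \<in> A \<Longrightarrow> {t, x} \<notin> E" "\<And>t x. t \<in> D \<Longrightarrow> x \<in> D \<Longrightarrow> {t, x} \<notin> E"
    and finL: "\<And>u. u \<in> U \<Longrightarrow> finite (L u)"
    and LA: "\<And>a. a \<in> A \<Longrightarrow> card (nbrs a U) + card (nbrs a D) < card (L a)"
      "\<And>a. a \<in> A \<Longrightarrow> card (nbrs a U) + 1 < card (L a)"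
    and Lv: "card (nbrs v U) + 1 < card (L v)"
    and \<gamma>: "proper U \<gamma>" and \<beta>: "proper U \<beta>"
    and eq: "\<And>u. u \<in> U - insert v (A \<union> D) \<Longrightarrow> \<gamma> u = \<beta> u"
  obtains ns where "valid U \<gamma> ns" "\<And>u. u \<in> U \<Longrightarrow> run \<gamma> ns u = \<beta> u"
    "\<And>u. u \<in> A \<Longrightarrow> moves u ns \<le> 3" "\<And>u. u \<in> D \<Longrightarrow> moves u ns \<le> 1" "moves v ns \<le> 2"
    "\<And>u. u \<in> U - insert v (A \<union> D) \<Longrightarrow> moves u ns = 0"
proof -
  have finA: "finite A" "finite D" using sub fin finite_subset by auto
  have fn: "finite (nbrs x T)" if "T \<subseteq> U" for x T
    using that fin finite_nbrs finite_subset by metis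
  have \<beta>L: "\<beta> u \<in> L u" if "u \<in> U" for u using \<beta> that by (auto simp: proper_def)
  have \<beta>n: "\<beta> u \<noteq> \<beta> t" if "t \<in> U" "u \<in> nbrs t U" for u t using proper_nbr_neq[OF \<beta>] that by auto
  have nU: "u \<in> U" "{u, t} \<in> E" if "u \<in> nbrs t U" for u t using that by (auto simp: nbrs_def)
  have "\<exists>c. c \<in> L a \<and> c \<notin> \<gamma> ` nbrs a U \<union> \<beta> ` nbrs a D" if a: "a \<in> A" for a
  proof -
    have "card (\<gamma> ` nbrs a U \<union> \<beta> ` nbrs a D) \<le> card (\<gamma> ` nbrs a U) + card (\<beta> ` nbrs a D)"
      by (rule card_Un_le)
    also have "\<dots> \<le> card (nbrs a U) + card (nbrs a D)"
      by (intro add_mono card_image_le fn sub order_refl)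
    also note LA(1)[OF a]
    finally show ?thesis
      by (intro avoid_colors) (use finL[of a] a sub fn[of U a] fn[of D a] in auto)
  qed
  then obtain \<tau>1 where \<tau>1: "\<And>a. a \<in> A \<Longrightarrow> \<tau>1 a \<in> L a \<and> \<tau>1 a \<notin> \<gamma> ` nbrs a U \<union> \<beta> ` nbrs a D"
    by metis
  have \<tau>1L: "\<tau>1 a \<in> L a" if "a \<in> A" for a using \<tau>1 that by blast
  have \<tau>1n: "\<gamma> u \<noteq> \<tau>1 a" if "a \<in> A" "u \<in> nbrs a U" for a u using \<tau>1[OF that(1)] that(2) by force
  obtain n1 where n1: "valid U \<gamma> n1" "run \<gamma> n1 = (\<lambda>u. if u \<in> A then \<tau>1 u else \<gamma> u)"
    "\<And>u. moves u n1 = (if u \<in> A then 1 else 0)"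
    by (rule move_set[OF finA(1) sub(2) \<gamma> indep(1), of \<tau>1, OF _ _ \<tau>1L \<tau>1n]) (assumption+, rule that)
  define \<gamma>1 where "\<gamma>1 = run \<gamma> n1"
  have A1: "\<gamma>1 a \<noteq> \<beta> d" if "a \<in> A" "d \<in> D" "a \<in> nbrs d U" for a d
  proof -
    have "d \<in> nbrs a D" using that by (auto simp: nbrs_def insert_commute)
    then show ?thesis using \<tau>1[OF that(1)] that n1(2) unfolding \<gamma>1_def by auto
  qed
  have e1: "\<gamma>1 u = \<beta> u" if "u \<in> U - insert v (A \<union> D)" for u using eq that n1(2) \<gamma>1_def by auto
  define D1 where "D1 = {d \<in> D. \<beta> d \<noteq> \<gamma>1 v}"
  have D1: "D1 \<subseteq> D" using D1_def by auto
  have p1: "proper U \<gamma>1" using valid_run[OF n1(1)] \<gamma>1_def by simp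
  obtain n2 where n2: "valid U \<gamma>1 n2" "run \<gamma>1 n2 = (\<lambda>u. if u \<in> D1 then \<beta> u else \<gamma>1 u)"
    "\<And>u. moves u n2 = (if u \<in> D1 then 1 else 0)"
  proof (rule move_set[OF finite_subset[OF D1 finA(2)] _ p1, of \<beta>])
    show "\<gamma>1 u \<noteq> \<beta> t" if "t \<in> D1" "u \<in> nbrs t U" for t u
    proof -
      have t: "t \<in> D" "t \<in> U" "\<beta> t \<noteq> \<gamma>1 v" using that D1_def sub by auto
      have "u \<in> U" using nU(1) that by blast
      then consider "u = v" | "u \<in> A" | "u \<in> D" | "u \<in> U - insert v (A \<union> D)" by blast
      then show ?thesis
        using A1 t that nU(2)[OF that(2)] indep(2)[of u t] e1 \<beta>n[OF t(2) that(2)] by cases auto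
    qed
    show "{t, x} \<notin> E" if "t \<in> D1" "x \<in> D1" for t x using indep(2) D1 that by blast
    show "D1 \<subseteq> U" using D1 sub by blast
    show "\<beta> t \<in> L t" if "t \<in> D1" for t using \<beta>L D1 sub that by blast
  qed (rule that)
  define \<gamma>2 where "\<gamma>2 = run \<gamma>1 n2"
  have p2: "proper U \<gamma>2" using valid_run[OF n2(1)] \<gamma>2_def by simp
  \<comment> \<open>The present colour of \<open>v\<close> is excluded explicitly, since
    \<open>D - D1\<close> waits for it to be vacated.\<close>
  have "card (insert (\<gamma>2 v) (\<gamma>2 ` nbrs v U)) < card (L v)"
    using card_image_le[OF fn[OF order_refl], of \<gamma>2 v] Lv fn[OF order_refl, of v]
    by (simp add: card_insert_if)
  then obtain c where c: "c \<in> L v" "c \<notin> insert (\<gamma>2 v) (\<gamma>2 ` nbrs v U)"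
    using avoid_colors[of v "insert (\<gamma>2 v) (\<gamma>2 ` nbrs v U)"] finL[of v] sub fn[of U v] by blast
  obtain n3 where n3: "valid U \<gamma>2 n3" "run \<gamma>2 n3 = (\<lambda>u. if u \<in> {v} then c else \<gamma>2 u)"
    "\<And>u. moves u n3 = (if u \<in> {v} then 1 else 0)"
    by (rule move_set[of "{v}" U \<gamma>2 "\<lambda>_. c"]) (use sub p2 c loopless[of v] in auto)
  define \<gamma>3 where "\<gamma>3 = run \<gamma>2 n3"
  have p3: "proper U \<gamma>3" using valid_run[OF n3(1)] \<gamma>3_def by simp
  have v12: "\<gamma>2 v = \<gamma>1 v" using n2(2) D1 disj \<gamma>2_def by auto
  have g3: "\<gamma>3 u = (if u = v then c else if u \<in> D1 then \<beta> u else \<gamma>1 u)" for u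
    using n3(2) n2(2) \<gamma>3_def \<gamma>2_def by auto
  obtain n4 where n4: "valid U \<gamma>3 n4" "run \<gamma>3 n4 = (\<lambda>u. if u \<in> D - D1 then \<beta> u else \<gamma>3 u)"
    "\<And>u. moves u n4 = (if u \<in> D - D1 then 1 else 0)"
  proof (rule move_set[OF _ _ p3, of "D - D1" \<beta>])
    show "\<gamma>3 u \<noteq> \<beta> t" if "t \<in> D - D1" "u \<in> nbrs t U" for t u
    proof -
      have t: "t \<in> D" "t \<in> U" "\<beta> t = \<gamma>1 v" using that D1_def sub by auto
      have "u \<in> U" using nU(1) that by blast
      then consider "u = v" | "u \<in> A" | "u \<in> D" | "u \<in> U - insert v (A \<union> D)" by blast
      then show ?thesis
      proof cases
        case 1
        then show ?thesis using g3 t c v12 by auto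
      next
        case 2
        then show ?thesis using g3 A1[OF 2 t(1) that(2)] D1 disj by auto
      next
        case 3
        then show ?thesis using t nU(2)[OF that(2)] indep(2)[of u t] by auto
      next
        case 4
        then show ?thesis using g3 e1[OF 4] \<beta>n[OF t(2) that(2)] by auto
      qed
    qed
    show "{t, x} \<notin> E" if "t \<in> D - D1" "x \<in> D - D1" for t x using indep(2) that by blast
    show "finite (D - D1)" using finA by blast
    show "D - D1 \<subseteq> U" using sub by blast
    show "\<beta> t \<in> L t" if "t \<in> D - D1" for t using \<beta>L sub that by blast
  qed (rule that)
  define \<gamma>4 where "\<gamma>4 = run \<gamma>3 n4"
  have p4: "proper U \<gamma>4" using valid_run[OF n4(1)] \<gamma>4_def by simp
  have g4: "\<gamma>4 u = \<beta> u" if "u \<in> U - insert v A" for u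
    using that n4(2) g3 e1[of u] D1 unfolding \<gamma>4_def by auto
  \<comment> \<open>Now \<open>A\<close> makes room a second time, for the target colour of
    \<open>v\<close>; then \<open>v\<close> and at last \<open>A\<close> reach their targets. In
    total each vertex of \<open>A\<close> moves three times, \<open>v\<close> twice and each vertex
    of \<open>D\<close> once.\<close>
  have "\<exists>c. c \<in> L a \<and> c \<notin> insert (\<beta> v) (\<gamma>4 ` nbrs a U)" if a: "a \<in> A" for a
  proof -
    have "card (insert (\<beta> v) (\<gamma>4 ` nbrs a U)) \<le> Suc (card (\<gamma>4 ` nbrs a U))"
      using fn[OF order_refl] by (simp add: card_insert_if)
    also have "\<dots> < card (L a)" using card_image_le[OF fn[OF order_refl], of \<gamma>4 a] LA(2)[OF a] by simp
    finally show ?thesis by (intro avoid_colors) (use finL[of a] a sub fn[of U a] in auto)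
  qed
  then obtain \<tau>5 where \<tau>5: "\<And>a. a \<in> A \<Longrightarrow> \<tau>5 a \<in> L a \<and> \<tau>5 a \<notin> insert (\<beta> v) (\<gamma>4 ` nbrs a U)"
    by metis
  have \<tau>5L: "\<tau>5 a \<in> L a" if "a \<in> A" for a using \<tau>5 that by blast
  have \<tau>5n: "\<gamma>4 u \<noteq> \<tau>5 a" if "a \<in> A" "u \<in> nbrs a U" for a u using \<tau>5[OF that(1)] that(2) by force
  obtain n5 where n5: "valid U \<gamma>4 n5" "run \<gamma>4 n5 = (\<lambda>u. if u \<in> A then \<tau>5 u else \<gamma>4 u)"
    "\<And>u. moves u n5 = (if u \<in> A then 1 else 0)"
    by (rule move_set[OF finA(1) sub(2) p4 indep(1), of \<tau>5, OF _ _ \<tau>5L \<tau>5n]) (assumption+, rule that)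
  define \<gamma>5 where "\<gamma>5 = run \<gamma>4 n5"
  have p5: "proper U \<gamma>5" using valid_run[OF n5(1)] \<gamma>5_def by simp
  obtain n6 where n6: "valid U \<gamma>5 n6" "run \<gamma>5 n6 = (\<lambda>u. if u \<in> {v} then \<beta> u else \<gamma>5 u)"
    "\<And>u. moves u n6 = (if u \<in> {v} then 1 else 0)"
  proof (rule move_set[OF _ _ p5, of "{v}" \<beta>])
    show "\<gamma>5 u \<noteq> \<beta> t" if "t \<in> {v}" "u \<in> nbrs t U" for t u
    proof (cases "u \<in> A")
      case True
      then show ?thesis using n5(2) \<tau>5[OF True] that \<gamma>5_def by auto
    next
      case False
      have "u \<noteq> v" using that not_in_nbrs by blast
      then show ?thesis using False n5(2) g4[of u] that nU[OF that(2)] \<beta>n[of v u] sub loopless[of v] \<gamma>5_def by auto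
    qed
  qed (use sub \<beta>L loopless[of v] in auto)
  define \<gamma>6 where "\<gamma>6 = run \<gamma>5 n6"
  have p6: "proper U \<gamma>6" using valid_run[OF n6(1)] \<gamma>6_def by simp
  have g6: "\<gamma>6 u = \<beta> u" if "u \<in> U - A" for u
    using that n6(2) n5(2) g4[of u] unfolding \<gamma>6_def \<gamma>5_def by auto
  obtain n7 where n7: "valid U \<gamma>6 n7" "run \<gamma>6 n7 = (\<lambda>u. if u \<in> A then \<beta> u else \<gamma>6 u)"
    "\<And>u. moves u n7 = (if u \<in> A then 1 else 0)"
  proof (rule move_set[OF finA(1) sub(2) p6, of \<beta>])
    show "\<gamma>6 u \<noteq> \<beta> t" if "t \<in> A" "u \<in> nbrs t U" for t u
    proof -
      have "u \<in> U - A" using nU[OF that(2)] indep(1)[of u t] that by blast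
      then show ?thesis using g6[of u] that \<beta>n[of t u] sub by auto
    qed
    show "{t, x} \<notin> E" if "t \<in> A" "x \<in> A" for t x using indep(1) that by blast
    show "\<beta> t \<in> L t" if "t \<in> A" for t using \<beta>L sub that by blast
  qed (rule that)
  define ns where "ns = n1 @ n2 @ n3 @ n4 @ n5 @ n6 @ n7"
  show ?thesis
  proof (rule that[of ns])
    show "valid U \<gamma> ns"
      using n1(1) n2(1) n3(1) n4(1) n5(1) n6(1) n7(1)
      unfolding ns_def valid_append \<gamma>1_def \<gamma>2_def \<gamma>3_def \<gamma>4_def \<gamma>5_def \<gamma>6_def by simp
    show "run \<gamma> ns u = \<beta> u" if "u \<in> U" for u
    proof -
      have "run \<gamma> ns = run \<gamma>6 n7"
        unfolding ns_def run_append \<gamma>1_def \<gamma>2_def \<gamma>3_def \<gamma>4_def \<gamma>5_def \<gamma>6_def by simp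
      then show ?thesis using n7(2) g6[of u] that by auto
    qed
    have mv: "moves u ns = (if u \<in> A then 3 else 0) + (if u \<in> D then 1 else 0) + (if u = v then 2 else 0)" for u
      using n1(3)[of u] n2(3)[of u] n3(3)[of u] n4(3)[of u] n5(3)[of u] n6(3)[of u] n7(3)[of u] D1 disj
      unfolding ns_def by auto
    show "moves u ns \<le> 3" if "u \<in> A" for u using that disj unfolding mv by auto
    show "moves u ns \<le> 1" if "u \<in> D" for u using that disj unfolding mv by auto
    show "moves v ns \<le> 2" using disj unfolding mv by auto
    show "moves u ns = 0" if "u \<in> U - insert v (A \<union> D)" for u using that unfolding mv by auto
  qed
qed

definition recolorable :: "'a set \<Rightarrow> bool" where
  "recolorable U \<longleftrightarrow> (\<forall>\<alpha> \<beta>. proper U \<alpha> \<longrightarrow> proper U \<beta> \<longrightarrow>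
     (\<exists>ms. valid U \<alpha> ms \<and> (\<forall>u\<in>U. run \<alpha> ms u = \<beta> u) \<and> (\<forall>u\<in>U. moves u ms \<le> 12)))"

section \<open>Reducible configurations and discharging\<close>

text \<open>The edges inside \<open>W\<close> form a matching. An arbitrary injection
  \<open>f\<close> into the naturals decides which end of a matching edge goes to \<open>A\<close>
  (the smaller one) and which to \<open>B\<close>. If \<open>A\<close> is nonempty, then a matching
  edge has two ends outside \<open>P\<close>.\<close>

lemma matching_partition:
  assumes "finite W" and deg: "\<And>w. w \<in> W \<Longrightarrow> card (nbrs w W) \<le> 1"
  obtains A B P where "W = A \<union> B \<union> P" "A \<inter> B = {}" "A \<inter> P = {}" "B \<inter> P = {}"
    "\<And>t x. t \<in> A \<Longrightarrow> x \<in> A \<Longrightarrow> {t, x} \<notin> E" "\<And>t x. t \<in> B \<Longrightarrow> x \<in> B \<Longrightarrow> {t, x} \<notin> E"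
    "\<And>p w. p \<in> P \<Longrightarrow> w \<in> W \<Longrightarrow> {p, w} \<notin> E"
    "\<And>a. a \<in> A \<Longrightarrow> card (nbrs a B) = 1" "\<And>b. b \<in> B \<Longrightarrow> card (nbrs b A) = 1"
    "A \<noteq> {} \<Longrightarrow> card P + 2 \<le> card W"
proof -
  obtain f :: "'a \<Rightarrow> nat" where f: "inj_on f W"
    using finite_imp_inj_to_nat_seg[OF assms(1)] by auto
  have uniq: "x = y" if "w \<in> W" "x \<in> nbrs w W" "y \<in> nbrs w W" for w x y
    using deg[OF that(1)] card_le_Suc0_iff_eq[OF finite_nbrs[OF assms(1)], of w] that by auto
  define A where "A = {w \<in> W. \<exists>x\<in>nbrs w W. f w < f x}"
  define B where "B = {w \<in> W. \<exists>x\<in>nbrs w W. f x < f w}"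
  define P where "P = {w \<in> W. nbrs w W = {}}"
  have sub: "A \<subseteq> W" "B \<subseteq> W" "P \<subseteq> W" by (auto simp: A_def B_def P_def)
  have ne: "f w < f x \<or> f x < f w" if "w \<in> W" "x \<in> nbrs w W" for w x
    using f that not_in_nbrs[of w W] unfolding inj_on_def nbrs_def
    by (metis (no_types, lifting) linorder_neqE_nat mem_Collect_eq that(2))
  have W: "W = A \<union> B \<union> P" using ne by (fastforce simp: A_def B_def P_def)
  have AB: "A \<inter> B = {}" "A \<inter> P = {}" "B \<inter> P = {}"
    using uniq by (auto simp: A_def B_def P_def dest: less_asym)
  have mem: "x \<in> nbrs t W" if "{t, x} \<in> E" "x \<in> W" for t x
    using that by (auto simp: nbrs_def insert_commute)
  have Ai: "{t, x} \<notin> E" if "t \<in> A" "x \<in> A" for t x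
  proof
    assume e: "{t, x} \<in> E"
    have *: "x \<in> nbrs t W" "t \<in> nbrs x W" using mem[OF e] mem[of x t] e that sub by (auto simp: insert_commute)
    then have "f t < f x" "f x < f t" using that uniq unfolding A_def by blast+
    then show False by simp
  qed
  have Bi: "{t, x} \<notin> E" if "t \<in> B" "x \<in> B" for t x
  proof
    assume e: "{t, x} \<in> E"
    have *: "x \<in> nbrs t W" "t \<in> nbrs x W" using mem[OF e] mem[of x t] e that sub by (auto simp: insert_commute)
    then have "f t < f x" "f x < f t" using that uniq unfolding B_def by blast+
    then show False by simp
  qed
  have Pi: "{p, w} \<notin> E" if "p \<in> P" "w \<in> W" for p w
    using that mem unfolding P_def by blast
  have cA: "card (nbrs a B) = 1" if a: "a \<in> A" for a
  proof -
    obtain x where x: "x \<in> nbrs a W" "f a < f x" using a A_def by auto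
    then have "x \<in> B" using a sub nbrs_sym[of x a W W] unfolding B_def nbrs_def by blast
    then have "nbrs a B = {x}" using x uniq[of a] a sub unfolding nbrs_def by blast
    then show ?thesis by simp
  qed
  have cB: "card (nbrs a A) = 1" if a: "a \<in> B" for a
  proof -
    obtain x where x: "x \<in> nbrs a W" "f x < f a" using a B_def by auto
    then have "x \<in> A" using a sub nbrs_sym[of x a W W] unfolding A_def nbrs_def by blast
    then have "nbrs a A = {x}" using x uniq[of a] a sub unfolding nbrs_def by blast
    then show ?thesis by simp
  qed
  have "card P + 2 \<le> card W" if neA: "A \<noteq> {}"
  proof -
    obtain a where a: "a \<in> A" using neA by auto
    have "nbrs a B \<noteq> {}" using cA[OF a] by auto
    then obtain b where b: "b \<in> B" by (auto simp: nbrs_def)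
    have "card (P \<union> {a, b}) \<le> card W" by (rule card_mono) (use assms(1) sub a b in auto)
    moreover have "card (P \<union> {a, b}) = card P + card {a, b}"
      by (rule card_Un_disjoint) (use AB a b assms(1) sub finite_subset in auto)
    moreover have "a \<noteq> b" using AB a b by blast
    then have "card {a, b} = 2" by simp
    ultimately show ?thesis by simp
  qed
  then show ?thesis using that W AB Ai Bi Pi cA cB by blast
qed

lemma card_nbrs_Un:
  assumes "finite S" "finite T" "S \<inter> T = {}"
  shows "card (nbrs x (S \<union> T)) = card (nbrs x S) + card (nbrs x T)"
proof -
  have "nbrs x (S \<union> T) = nbrs x S \<union> nbrs x T" "nbrs x S \<inter> nbrs x T = {}"
    using assms(3) by (auto simp: nbrs_def)
  then show ?thesis using assms finite_nbrs by (simp add: card_Un_disjoint)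
qed

lemma length_nbr_colors_le:
  assumes "finite U" "valid U \<phi> ms" "\<And>u. u \<in> nbrs w U \<Longrightarrow> moves u ms \<le> k"
  shows "length (nbr_colors w ms) \<le> card (nbrs w U) * k"
  using length_nbr_colors[OF assms(1) fst_valid_subset[OF assms(2)], of w]
    sum_bounded_above[of "nbrs w U" "\<lambda>u. moves u ms" k] assms(3) by simp

text \<open>\<open>W\<close> is split into its unmatched part \<open>P\<close>, which is treated together with the hub \<open>v\<close>, and the two
  sides \<open>A\<close>, \<open>B\<close> of a matching, which are inserted afterwards in this order: a vertex of \<open>B\<close> then sees
  at most \<open>4 + 6 + 12 = 22\<close> moves of \<open>v\<close>, of its partner and of its outer neighbour.\<close>

lemma recolorable_reduce:
  assumes fin: "finite U" and v: "v \<in> U" and W: "W \<subseteq> nbrs v U"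
    and L: "\<And>u. u \<in> U \<Longrightarrow> finite (L u) \<and> card (L u) = 6"
    and degW: "\<And>w. w \<in> W \<Longrightarrow> card (nbrs w U) \<le> 3"
    and match: "\<And>w. w \<in> W \<Longrightarrow> card (nbrs w W) \<le> 1"
    and degv: "card (nbrs v U) \<le> 2 \<and> W = {} \<or> card (nbrs v U) = 3 \<and> card W = 2 \<or>
      card (nbrs v U) = 4 \<and> card W = 4"
    and IH: "recolorable (U - insert v W)"
  shows "recolorable U"
  unfolding recolorable_def
proof (intro allI impI)
  fix \<alpha> \<beta>
  assume \<alpha>: "proper U \<alpha>" and \<beta>: "proper U \<beta>"
  define U0 where "U0 = U - insert v W"
  have WU: "W \<subseteq> U" "v \<notin> W" "finite W"
    using W not_in_nbrs[of v U] finite_subset[OF W finite_nbrs[OF fin]] by (auto simp: nbrs_def)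
  have adj: "{w, v} \<in> E" if "w \<in> W" for w using W that by (auto simp: nbrs_def)
  have finU0: "finite U0" using fin U0_def by auto
  obtain A B P where ABP: "W = A \<union> B \<union> P" "A \<inter> B = {}" "A \<inter> P = {}" "B \<inter> P = {}"
    and Ai: "\<And>t x. t \<in> A \<Longrightarrow> x \<in> A \<Longrightarrow> {t, x} \<notin> E"
    and Bi: "\<And>t x. t \<in> B \<Longrightarrow> x \<in> B \<Longrightarrow> {t, x} \<notin> E"
    and Pi: "\<And>p w. p \<in> P \<Longrightarrow> w \<in> W \<Longrightarrow> {p, w} \<notin> E"
    and cA: "\<And>a. a \<in> A \<Longrightarrow> card (nbrs a B) = 1" and cB: "\<And>b. b \<in> B \<Longrightarrow> card (nbrs b A) = 1"
    and AP: "A \<noteq> {} \<Longrightarrow> card P + 2 \<le> card W"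
    by (rule matching_partition[OF WU(3) match]) (assumption, rule that)
  have finABP: "finite A" "finite B" "finite P" using ABP WU by auto
  have U: "U = U0 \<union> {v} \<union> (A \<union> B \<union> P)" using U0_def v WU ABP by auto
  have dj: "U0 \<inter> ({v} \<union> (A \<union> B \<union> P)) = {}" "v \<notin> A" "v \<notin> B" "v \<notin> P" "v \<notin> U0"
    using U0_def WU ABP by auto
  have cv: "nbrs w {v} = {v}" if "w \<in> W" for w using adj[OF that] by (auto simp: nbrs_def insert_commute)
  have Pe: "nbrs w P = {}" if "w \<in> W" for w using Pi that by (auto simp: nbrs_def)
  have nU: "card (nbrs x U) = card (nbrs x U0) + card (nbrs x {v}) +
      (card (nbrs x A) + card (nbrs x B) + card (nbrs x P))" for x
  proof -
    have "card (nbrs x U) = card (nbrs x (U0 \<union> {v})) + card (nbrs x (A \<union> B \<union> P))"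
      unfolding U by (rule card_nbrs_Un) (use finABP finU0 dj in auto)
    moreover have "card (nbrs x (U0 \<union> {v})) = card (nbrs x U0) + card (nbrs x {v})"
      by (rule card_nbrs_Un) (use finABP finU0 dj in auto)
    moreover have "card (nbrs x (A \<union> B \<union> P)) = card (nbrs x (A \<union> B)) + card (nbrs x P)"
      by (rule card_nbrs_Un) (use finABP ABP in auto)
    moreover have "card (nbrs x (A \<union> B)) = card (nbrs x A) + card (nbrs x B)"
      by (rule card_nbrs_Un) (use finABP ABP in auto)
    ultimately show ?thesis by simp
  qed
  have dW: "card (nbrs w U0) + card (nbrs w A) + card (nbrs w B) \<le> 2" if "w \<in> W" for w
    using nU[of w] degW[OF that] cv[OF that] by simp
  have "card (nbrs v U0) + card W = card (nbrs v U)"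
  proof -
    have "nbrs v W = W" using adj by (auto simp: nbrs_def)
    moreover have "nbrs v {v} = {}" using loopless[of v] by (auto simp: nbrs_def)
    moreover have "card (nbrs v U) = card (nbrs v (U0 \<union> {v})) + card (nbrs v W)"
      unfolding U ABP(1)[symmetric] by (rule card_nbrs_Un) (use WU finU0 dj ABP in auto)
    moreover have "card (nbrs v (U0 \<union> {v})) = card (nbrs v U0) + card (nbrs v {v})"
      by (rule card_nbrs_Un) (use finABP finU0 dj in auto)
    ultimately show ?thesis by simp
  qed
  then have dv: "card (nbrs v U0) \<le> 2 \<and> W = {} \<or> card (nbrs v U0) = 1 \<and> card W = 2 \<or>
      card (nbrs v U0) = 0 \<and> card W = 4" using degv by auto
  \<comment> \<open>Here \<open>\<rho>\<close> counts the spare colours of the hub, \<open>n\<close>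
    its moves forced by the outer neighbours, and each vertex of \<open>P\<close> may make it give
    way twice. The bound 10 leaves two moves to \<open>finish\<close>; the bound 4 is for the
    matched vertices, which see every move of \<open>v\<close>. Below, 24 = 3*8, 12 = 2*6 with 6 + 4
    = 10, and 12 = 4*3; in the last case the hub has no outer neighbour, and a nonempty
    \<open>A\<close> forces \<open>card P \<le> 2\<close>.\<close>
  have "\<exists>\<rho> n. card (nbrs v U0) + card P + 1 + \<rho> \<le> 6 \<and> 1 \<le> \<rho> \<and> card (nbrs v U0) * 12 \<le> \<rho> * n \<and>
      n + 2 * card P \<le> 10 \<and> (A \<noteq> {} \<longrightarrow> n + 2 * card P \<le> 4)"
  proof -
    have PW: "card P \<le> card W" using WU ABP by (auto intro: card_mono)
    from dv consider "card (nbrs v U0) \<le> 2" "W = {}"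
      | "card (nbrs v U0) = 1" "card W = 2" "A = {}"
      | "card (nbrs v U0) = 1" "card W = 2" "A \<noteq> {}"
      | "card (nbrs v U0) = 0" "card W = 4" by metis
    then show ?thesis
    proof cases
      case 1
      then show ?thesis using ABP by (intro exI[of _ 3] exI[of _ 8]) auto
    next
      case 2
      then show ?thesis using PW by (intro exI[of _ 2] exI[of _ 6]) auto
    next
      case 3
      then show ?thesis using AP by (intro exI[of _ 4] exI[of _ 3]) auto
    next
      case 4
      then show ?thesis using PW AP by (intro exI[of _ 1] exI[of _ 0]) auto
    qed
  qed
  then obtain \<rho> n where \<rho>n: "card (nbrs v U0) + card P + 1 + \<rho> \<le> 6" "1 \<le> \<rho>"
    "card (nbrs v U0) * 12 \<le> \<rho> * n" "n + 2 * card P \<le> 10" "A \<noteq> {} \<Longrightarrow> n + 2 * card P \<le> 4" by blast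
  have "proper U0 \<alpha>" "proper U0 \<beta>" using \<alpha> \<beta> U proper_mono by blast+
  with IH obtain ms0 where ms0: "valid U0 \<alpha> ms0" "\<forall>u\<in>U0. run \<alpha> ms0 u = \<beta> u" "\<forall>u\<in>U0. moves u ms0 \<le> 12"
    unfolding recolorable_def U0_def by blast
  have ev0: "length (nbr_colors w ms0) \<le> card (nbrs w U0) * 12" for w
    by (rule length_nbr_colors_le[OF finU0 ms0(1)]) (use ms0(3) in \<open>auto simp: nbrs_def\<close>)
  define U1 where "U1 = U0 \<union> insert v P"
  obtain ms1 where ms1: "valid U1 \<alpha> ms1" "moves_in U0 ms1 = ms0" "\<And>p. p \<in> P \<Longrightarrow> moves p ms1 \<le> 11"
    "moves v ms1 \<le> n + sum (\<lambda>_. 2) P"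
  proof (rule hub_extension[of U0 P v \<rho> \<alpha> ms0 "\<lambda>_. 11" "\<lambda>_. 2" n])
    show "length (nbr_colors w ms0) \<le> 2 * 11 + min 2 11" if "w \<in> P" for w
      using ev0[of w] dW[of w] that ABP by simp
    show "length (nbr_colors v ms0) \<le> \<rho> * n" using ev0[of v] \<rho>n by simp
    show "card (nbrs w U0) + 4 \<le> card (L w)" if "w \<in> P" for w
      using dW[of w] that ABP L[of w] WU by auto
    show "proper (U0 \<union> insert v P) \<alpha>" by (rule proper_mono[OF \<alpha>]) (use U in auto)
  qed (use finU0 finABP dj adj Pi ABP L WU v \<rho>n ms0 U1_def that in auto)
  have mv1: "moves v ms1 \<le> n + 2 * card P" using ms1(4) by simp
  have m10: "moves u ms1 \<le> 12" if "u \<in> U0" for u using moves_moves_in[OF that, of ms1] ms1(2) bspec[OF ms0(3) that] by simp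
  have U1: "finite U1" "U1 = U0 \<union> ({v} \<union> P)" using finU0 finABP U1_def by auto
  have nU1: "nbrs w U1 = insert v (nbrs w U0)" "v \<notin> nbrs w U0" if "w \<in> W" for w
    using Pe[OF that] cv[OF that] dj unfolding U1 by (auto simp: nbrs_def)
  have ev1: "length (nbr_colors w ms1) \<le> (n + 2 * card P) + card (nbrs w U0) * 12" if "w \<in> W" for w
  proof -
    have "length (nbr_colors w ms1) = moves v ms1 + (\<Sum>u\<in>nbrs w U0. moves u ms1)"
      using length_nbr_colors[OF U1(1) fst_valid_subset[OF ms1(1)], of w] nU1[OF that] finite_nbrs[OF finU0] by simp
    moreover have "(\<Sum>u\<in>nbrs w U0. moves u ms1) \<le> card (nbrs w U0) * 12"
      using sum_bounded_above[of "nbrs w U0" "\<lambda>u. moves u ms1" 12] m10 by (simp add: nbrs_def)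
    ultimately show ?thesis using mv1 by simp
  qed
  have cU1: "card (nbrs w U1) = 1 + card (nbrs w U0)" if "w \<in> W" for w
    using nU1[OF that] finite_nbrs[OF finU0] by simp
  define U2 where "U2 = U1 \<union> A"
  \<comment> \<open>In \<open>U1\<close> a vertex of \<open>A\<close> sees \<open>v\<close> and at
    most one further vertex, so it has 3 spare colours and at most 4 + 12 = 16 events;
    \<open>6\<close> moves cover 18. A small number is essential, as these moves become events at
    \<open>B\<close>.\<close>
  obtain ms2 where ms2: "valid U2 \<alpha> ms2" "moves_in U1 ms2 = ms1" "\<And>a. a \<in> A \<Longrightarrow> moves a ms2 \<le> 6"
  proof (rule key_extension[of U1 A 3 \<alpha> ms1 6])
    show "finite (L a) \<and> card (nbrs a U1) + 1 + 3 \<le> card (L a)" if "a \<in> A" for a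
      using dW[of a] cA[OF that] cU1[of a] that ABP L[of a] WU by auto
    show "length (nbr_colors a ms1) \<le> 3 * 6" if "a \<in> A" for a
    proof -
      have "n + 2 * card P \<le> 4" "card (nbrs a U0) \<le> 1" using \<rho>n(5) dW[of a] cA[OF that] ABP that by auto
      then show ?thesis using ev1[of a] that ABP by auto
    qed
    show "proper (U1 \<union> A) \<alpha>" by (rule proper_mono[OF \<alpha>]) (use U U1 in auto)
    show "A \<inter> U1 = {}" using dj ABP U1 by auto
  qed (use U1 finABP ms1 Ai U2_def that in auto)
  have U2: "finite U2" "B \<inter> U2 = {}" "U2 \<union> B = U" using U2_def U1 finABP dj ABP U by auto
  have v1: "v \<in> U1" "U0 \<subseteq> U1" using U1 by auto
  have m20: "moves u ms2 \<le> 12" if "u \<in> U0" for u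
    using moves_moves_in[of u U1 ms2] m10[OF that] ms2(2) that v1 by auto
  have mv2: "moves v ms2 \<le> n + 2 * card P"
    using moves_moves_in[of v U1 ms2] mv1 ms2(2) v1 by auto
  have nU2: "nbrs b U2 = nbrs b U1 \<union> nbrs b A" "nbrs b U1 \<inter> nbrs b A = {}" for b
    using U1 dj ABP unfolding U2_def nbrs_def by auto
  have cU2: "card (nbrs b U2) \<le> 3" if "b \<in> B" for b
    using nU2[of b] cU1[of b] that ABP dW[of b] finite_nbrs[OF U1(1)] finite_nbrs[OF finABP(1)]
    by (simp add: card_Un_disjoint)
  obtain ms3 where ms3: "valid U \<alpha> ms3" "moves_in U2 ms3 = ms2" "\<And>b. b \<in> B \<Longrightarrow> moves b ms3 \<le> 11"
  proof (rule key_extension[of U2 B 2 \<alpha> ms2 11])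
    show "finite (L b) \<and> card (nbrs b U2) + 1 + 2 \<le> card (L b)" if "b \<in> B" for b
      using cU2[OF that] that ABP L[of b] WU by auto
    show "length (nbr_colors b ms2) \<le> 2 * 11" if b: "b \<in> B" for b
    proof -
      have bW: "b \<in> W" using b ABP by auto
      have "A \<noteq> {}" using cB[OF b] by (auto simp: nbrs_def)
      then have n4: "n + 2 * card P \<le> 4" "card (nbrs b U0) \<le> 1" using \<rho>n(5) dW[OF bW] cB[OF b] by auto
      have "length (nbr_colors b ms2) = (\<Sum>u\<in>nbrs b U1. moves u ms2) + (\<Sum>u\<in>nbrs b A. moves u ms2)"
        using length_nbr_colors[OF U2(1) fst_valid_subset[OF ms2(1)], of b] nU2[of b]
          finite_nbrs[OF U1(1)] finite_nbrs[OF finABP(1)] by (simp add: sum.union_disjoint)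
      also have "(\<Sum>u\<in>nbrs b U1. moves u ms2) = moves v ms2 + (\<Sum>u\<in>nbrs b U0. moves u ms2)"
        using nU1[OF bW] finite_nbrs[OF finU0] by simp
      finally have "length (nbr_colors b ms2) = moves v ms2 + (\<Sum>u\<in>nbrs b U0. moves u ms2) + (\<Sum>u\<in>nbrs b A. moves u ms2)" .
      moreover have "(\<Sum>u\<in>nbrs b U0. moves u ms2) \<le> card (nbrs b U0) * 12"
        using sum_bounded_above[of "nbrs b U0" "\<lambda>u. moves u ms2" 12] m20 by (simp add: nbrs_def)
      moreover have "(\<Sum>u\<in>nbrs b A. moves u ms2) \<le> card (nbrs b A) * 6"
        using sum_bounded_above[of "nbrs b A" "\<lambda>u. moves u ms2" 6] ms2(3) by (simp add: nbrs_def)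
      ultimately show ?thesis using n4 mv2 cB[OF b] by simp
    qed
    show "proper (U2 \<union> B) \<alpha>" using \<alpha> U2 by simp
  qed (use U2 finABP ms2 Bi that in auto)
  have m3: "moves u ms3 = moves u ms2" if "u \<in> U2" for u using moves_moves_in[OF that, of ms3] ms3(2) by simp
  have m3A: "moves a ms3 \<le> 6" if "a \<in> A" for a using m3[of a] ms2(3)[OF that] that U2_def by auto
  have m3v: "moves v ms3 \<le> 10" using m3[of v] mv2 \<rho>n(4) v1 U2_def by auto
  have m3P: "moves p ms3 \<le> 11" if "p \<in> P" for p
    using m3[of p] moves_moves_in[of p U1 ms2] ms2(2) ms1(3)[OF that] that U1 U2_def by auto
  have m30: "moves u ms3 \<le> 12" if "u \<in> U0" for u using m3[of u] m20[OF that] that U2_def v1 by auto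
  have on3: "moves_in U0 ms3 = ms0"
    using moves_in_idem[of U0 U2 ms3] moves_in_idem[of U0 U1 ms2] ms3(2) ms2(2) ms1(2) v1 U2_def
    by (metis le_supI1)
  define \<gamma> where "\<gamma> = run \<alpha> ms3"
  have \<gamma>0: "\<gamma> u = \<beta> u" if "u \<in> U0" for u
    using run_moves_in[OF that, of \<alpha> \<alpha> ms3] on3 ms0(2) that \<gamma>_def by simp
  have Dsub: "P \<union> B \<subseteq> W" "A \<subseteq> W" using ABP by auto
  obtain ns where ns: "valid U \<gamma> ns" "\<And>u. u \<in> U \<Longrightarrow> run \<gamma> ns u = \<beta> u"
    "\<And>u. u \<in> A \<Longrightarrow> moves u ns \<le> 3" "\<And>u. u \<in> P \<union> B \<Longrightarrow> moves u ns \<le> 1" "moves v ns \<le> 2"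
    "\<And>u. u \<in> U - insert v (A \<union> (P \<union> B)) \<Longrightarrow> moves u ns = 0"
  proof (rule finish[of U v A "P \<union> B" \<gamma> \<beta>])
    show "{t, x} \<notin> E" if "t \<in> P \<union> B" "x \<in> P \<union> B" for t x
      using that Pi[of t x] Pi[of x t] Bi[of t x] Dsub by (auto simp: insert_commute)
    show "card (nbrs a U) + card (nbrs a (P \<union> B)) < card (L a)" if "a \<in> A" for a
    proof -
      have "nbrs a (P \<union> B) = nbrs a B" using Pe[of a] that Dsub by (auto simp: nbrs_def)
      moreover have "a \<in> W" "a \<in> U" using that Dsub WU by auto
      ultimately show ?thesis using degW[of a] cA[OF that] L[of a] by simp
    qed
    show "card (nbrs a U) + 1 < card (L a)" if "a \<in> A" for a
    proof -
      have "a \<in> W" "a \<in> U" using that Dsub WU by auto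
      then show ?thesis using degW[of a] L[of a] by simp
    qed
    show "card (nbrs v U) + 1 < card (L v)" using degv L[OF v] by auto
    show "proper U \<gamma>" using valid_run[OF ms3(1)] \<gamma>_def by simp
    show "\<gamma> u = \<beta> u" if "u \<in> U - insert v (A \<union> (P \<union> B))" for u using \<gamma>0[of u] that U by auto
  qed (use fin v Dsub WU dj ABP Ai L \<beta> that in auto)
  show "\<exists>ms. valid U \<alpha> ms \<and> (\<forall>u\<in>U. run \<alpha> ms u = \<beta> u) \<and> (\<forall>u\<in>U. moves u ms \<le> 12)"
  proof (intro exI[of _ "ms3 @ ns"] conjI ballI)
    show "valid U \<alpha> (ms3 @ ns)" using ms3(1) ns(1) \<gamma>_def by (simp add: valid_append)
    show "run \<alpha> (ms3 @ ns) u = \<beta> u" if "u \<in> U" for u using ns(2)[OF that] \<gamma>_def by (simp add: run_append)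
    \<comment> \<open>The totals of both phases are 10 + 2 for \<open>v\<close>, 6 + 3 on
      \<open>A\<close>, 11 + 1 on \<open>P\<close> and \<open>B\<close>, and 12 + 0 on
      \<open>U0\<close>.\<close>
    show "moves u (ms3 @ ns) \<le> 12" if uU: "u \<in> U" for u
    proof -
      consider "u = v" | "u \<in> A" | "u \<in> P" | "u \<in> B" | "u \<in> U0" "u \<in> U - insert v (A \<union> (P \<union> B))"
        using uU U by blast
      then show ?thesis
      proof cases
        case 1
        then show ?thesis using m3v ns(5) by simp
      next
        case 2
        then show ?thesis using m3A[OF 2] ns(3)[OF 2] by simp
      next
        case 3
        then show ?thesis using m3P[OF 3] ns(4)[of u] by simp
      next
        case 4
        then show ?thesis using ms3(3)[OF 4] ns(4)[of u] by simp
      next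
        case 5
        then show ?thesis using m30 ns(6) by simp
      qed
    qed
  qed
qed

section \<open>Counting edges, discharging and the induction\<close>

lemma card_nbrs_eq_sum:
  "finite U \<Longrightarrow> card (nbrs v U) = (\<Sum>u\<in>U. if {u, v} \<in> E then 1 else 0)"
  by (simp add: nbrs_def sum.If_cases Int_def)

lemma nbrs_double_count:
  assumes "finite S" "finite T"
  shows "(\<Sum>v\<in>S. card (nbrs v T)) = (\<Sum>v\<in>T. card (nbrs v S))"
proof -
  have "(\<Sum>v\<in>S. card (nbrs v T)) = (\<Sum>v\<in>S. \<Sum>u\<in>T. if {u, v} \<in> E then 1 else 0)"
    using card_nbrs_eq_sum[OF assms(2)] by simp
  also have "\<dots> = (\<Sum>u\<in>T. \<Sum>v\<in>S. if {u, v} \<in> E then 1 else 0)" by (rule sum.swap)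
  also have "\<dots> = (\<Sum>v\<in>T. card (nbrs v S))"
    using card_nbrs_eq_sum[OF assms(1)] by (simp add: insert_commute)
  finally show ?thesis .
qed

lemma handshake:
  assumes "finite U" and two: "\<And>e. e \<in> E \<Longrightarrow> card e = 2"
  shows "(\<Sum>v\<in>U. card (nbrs v U)) = 2 * card {e \<in> E. e \<subseteq> U}"
proof -
  let ?F = "{e \<in> E. e \<subseteq> U}"
  have finF: "finite ?F" using finite_subset[of ?F "Pow U"] assms(1) by auto
  have "card (nbrs v U) = (\<Sum>e\<in>?F. if v \<in> e then 1 else 0)" if v: "v \<in> U" for v
  proof -
    have "bij_betw (\<lambda>u. {u, v}) (nbrs v U) {e \<in> ?F. v \<in> e}"
    proof (rule bij_betwI')
      show "({x, v} = {y, v}) = (x = y)" for x y by (auto simp: doubleton_eq_iff)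
      show "{x, v} \<in> {e \<in> ?F. v \<in> e}" if "x \<in> nbrs v U" for x using that v by (auto simp: nbrs_def)
      show "\<exists>x\<in>nbrs v U. e = {x, v}" if e: "e \<in> {e \<in> ?F. v \<in> e}" for e
      proof -
        have "card e = 2" using e two by auto
        then obtain x y where xy: "e = {x, y}" by (auto simp: card_2_iff)
        show ?thesis
        proof (cases "v = y")
          case True
          then show ?thesis using e xy by (intro bexI[of _ x]) (auto simp: nbrs_def)
        next
          case False
          then have "e = {y, v}" using e xy by auto
          then show ?thesis using e by (intro bexI[of _ y]) (auto simp: nbrs_def)
        qed
      qed
    qed
    then have "card (nbrs v U) = card {e \<in> ?F. v \<in> e}" by (rule bij_betw_same_card)
    also have "\<dots> = (\<Sum>e\<in>?F. if v \<in> e then 1 else 0)" using finF by (simp add: sum.If_cases Int_def)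
    finally show ?thesis .
  qed
  then have "(\<Sum>v\<in>U. card (nbrs v U)) = (\<Sum>v\<in>U. \<Sum>e\<in>?F. if v \<in> e then 1 else 0)" by simp
  also have "\<dots> = (\<Sum>e\<in>?F. \<Sum>v\<in>U. if v \<in> e then 1 else 0)" by (rule sum.swap)
  also have "\<dots> = (\<Sum>e\<in>?F. 2)"
  proof (rule sum.cong)
    fix e assume e: "e \<in> ?F"
    then have "U \<inter> {v. v \<in> e} = e" by auto
    then show "(\<Sum>v\<in>U. if v \<in> e then 1 else 0) = (2::nat)"
      using assms(1) two e by (simp add: sum.If_cases)
  qed simp
  finally show ?thesis by simp
qed

text \<open>Each vertex of degree 3 receives charge \<open>1/5\<close> from each neighbour of larger degree.\<close>

lemma discharging:
  assumes fin: "finite U" and deg: "\<And>v. v \<in> U \<Longrightarrow> 3 \<le> card (nbrs v U)"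
    and T: "T = {v \<in> U. card (nbrs v U) = 3}"
    and three: "\<And>v. v \<in> T \<Longrightarrow> card (nbrs v T) \<le> 1"
    and four: "\<And>v. v \<in> U \<Longrightarrow> card (nbrs v U) = 4 \<Longrightarrow> card (nbrs v T) \<le> 3"
  shows "17 * card U \<le> 5 * (\<Sum>v\<in>U. card (nbrs v U))"
proof -
  have TU: "T \<subseteq> U" "finite T" "finite (U - T)" using T fin by auto
  have U: "U = T \<union> (U - T)" using TU by auto
  have split: "card (nbrs v U) = card (nbrs v T) + card (nbrs v (U - T))" for v
    using card_nbrs_Un[OF TU(2,3), of v] U by auto
  \<comment> \<open>Charges are scaled by 5. A vertex of \<open>T\<close> starts with 15 and gains 1
    from each of at least two neighbours outside \<open>T\<close>. A vertex of degree 4 keeps at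
    least 20 - 3, and one of degree \<open>d \<ge> 5\<close> keeps at least
    \<open>4 * d\<close>.\<close>
  have 1: "17 \<le> 15 + card (nbrs v (U - T))" if "v \<in> T" for v
    using split[of v] three[OF that] that T by auto
  have 2: "17 + card (nbrs v T) \<le> 5 * card (nbrs v U)" if "v \<in> U - T" for v
    using split[of v] deg[of v] four[of v] that T by (cases "card (nbrs v U) = 4") auto
  have "17 * card U = 17 * card T + 17 * card (U - T)"
    using card_Un_disjoint[OF TU(2,3)] U by auto
  also have "17 * card T \<le> (\<Sum>v\<in>T. 15 + card (nbrs v (U - T)))"
    using sum_bounded_below[of T 17 "\<lambda>v. 15 + card (nbrs v (U - T))"] 1 by simp
  also have "\<dots> = (\<Sum>v\<in>T. 15) + (\<Sum>v\<in>U - T. card (nbrs v T))"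
    using nbrs_double_count[OF TU(2,3)] by (simp add: sum.distrib)
  also have "(\<Sum>v\<in>T. 15) + (\<Sum>v\<in>U - T. card (nbrs v T)) + 17 * card (U - T) =
      (\<Sum>v\<in>T. 15) + (\<Sum>v\<in>U - T. 17 + card (nbrs v T))"
    by (simp add: sum.distrib)
  also have "\<dots> \<le> (\<Sum>v\<in>T. 5 * card (nbrs v U)) + (\<Sum>v\<in>U - T. 5 * card (nbrs v U))"
    by (intro add_mono sum_mono) (use 2 T in auto)
  also have "\<dots> = (\<Sum>v\<in>U. 5 * card (nbrs v U))"
    using sum.union_disjoint[OF TU(2,3)] U by (metis Diff_disjoint)
  also have "\<dots> = 5 * (\<Sum>v\<in>U. card (nbrs v U))" by (simp add: sum_distrib_left)
  finally show ?thesis by simp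
qed

text \<open>The density bound is inherited by subsets, so induction on the number of vertices
  applies once a reducible configuration is found. Without one, \<open>discharging\<close> and
  \<open>handshake\<close> give \<open>17 * card U\<close> as a lower bound for ten times the number
  of edges in \<open>U\<close>, against sparsity.\<close>

lemma recolorable_if_sparse:
  assumes "finite U" and two: "\<And>e. e \<in> E \<Longrightarrow> card e = 2"
    and L: "\<And>u. u \<in> U \<Longrightarrow> finite (L u) \<and> card (L u) = 6"
    and sparse: "\<And>X. X \<subseteq> U \<Longrightarrow> X \<noteq> {} \<Longrightarrow> 10 * card {e \<in> E. e \<subseteq> X} < 17 * card X"
  shows "recolorable U"
  using assms(1) L sparse
proof (induction "card U" arbitrary: U rule: less_induct)
  case less
  note fin = less.prems(1) and L = less.prems(2) and sparse = less.prems(3)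
  show ?case
  proof (cases "U = {}")
    case True
    then show ?thesis unfolding recolorable_def by (auto intro!: exI[of _ "[]"])
  next
    case False
    have sub: "recolorable (U - insert v W)" if "v \<in> U" for v W
    proof (rule less.hyps)
      show "card (U - insert v W) < card U" using that fin by (intro psubset_card_mono) auto
      show "10 * card {e \<in> E. e \<subseteq> X} < 17 * card X" if "X \<subseteq> U - insert v W" "X \<noteq> {}" for X
        using that sparse[of X] by auto
    qed (use fin L in auto)
    define T where "T = {v \<in> U. card (nbrs v U) = 3}"
    have TU: "T \<subseteq> U" by (auto simp: T_def)
    have nT: "nbrs v T \<subseteq> nbrs v U" for v using TU by (auto simp: nbrs_def)
    have "\<exists>v\<in>U. card (nbrs v U) = 4 \<and> 4 \<le> card (nbrs v T)"
      if low: "\<not> (\<exists>v\<in>U. card (nbrs v U) \<le> 2)" and three: "\<not> (\<exists>v\<in>T. 2 \<le> card (nbrs v T))"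
    proof (rule ccontr)
      assume *: "\<not> ?thesis"
      have "17 * card U \<le> 5 * (\<Sum>v\<in>U. card (nbrs v U))"
      proof (rule discharging[OF fin _ T_def])
        show "3 \<le> card (nbrs v U)" if "v \<in> U" for v using low that by force
        show "card (nbrs v T) \<le> 1" if "v \<in> T" for v using three that by force
        show "card (nbrs v T) \<le> 3" if "v \<in> U" "card (nbrs v U) = 4" for v using * that by force
      qed
      then show False using handshake[OF fin two] sparse[OF order_refl False] by simp
    qed
    \<comment> \<open>The third alternative records that the second one fails: this makes the
      neighbours of the vertex of degree 4 span a matching. Two neighbours, as in the second
      alternative, always do.\<close>
    then consider (low) v where "v \<in> U" "card (nbrs v U) \<le> 2"
      | (three) v where "v \<in> T" "2 \<le> card (nbrs v T)"
      | (four) v where "v \<in> U" "card (nbrs v U) = 4" "4 \<le> card (nbrs v T)" "\<not> (\<exists>v\<in>T. 2 \<le> card (nbrs v T))"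
      by blast
    then show ?thesis
    proof cases
      case low
      then show ?thesis using recolorable_reduce[OF fin low(1) _ L, of "{}"] sub by auto
    next
      case three
      obtain W where W: "W \<subseteq> nbrs v T" "card W = 2" "finite W"
        using obtain_subset_with_card_n[OF three(2)] by metis
      have vU: "v \<in> U" using three(1) TU by auto
      show ?thesis
      proof (rule recolorable_reduce[OF fin vU _ L])
        show "W \<subseteq> nbrs v U" using W nT by blast
        show "card (nbrs w U) \<le> 3" if "w \<in> W" for w using that W by (auto simp: nbrs_def T_def)
        show "card (nbrs w W) \<le> 1" if "w \<in> W" for w
        proof -
          have "nbrs w W \<subseteq> W - {w}" using not_in_nbrs[of w W] by (auto simp: nbrs_def)
          then have "card (nbrs w W) \<le> card (W - {w})" using W by (intro card_mono) auto
          then show ?thesis using W that by simp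
        qed
      qed (use three W T_def sub vU in auto)
    next
      case four
      have eq: "nbrs v T = nbrs v U"
        by (rule card_seteq) (use four nT finite_nbrs[OF fin] in auto)
      show ?thesis
      proof (rule recolorable_reduce[OF fin four(1) _ L, of "nbrs v U"])
        show "card (nbrs w U) \<le> 3" if "w \<in> nbrs v U" for w
        proof -
          have "w \<in> T" using that eq by (auto simp: nbrs_def)
          then show ?thesis by (simp add: T_def)
        qed
        show "card (nbrs w (nbrs v U)) \<le> 1" if "w \<in> nbrs v U" for w
        proof -
          have wT: "w \<in> T" using that eq by (auto simp: nbrs_def)
          have "nbrs w (nbrs v U) \<subseteq> nbrs w T" unfolding eq[symmetric] by (auto simp: nbrs_def)
          then have "card (nbrs w (nbrs v U)) \<le> card (nbrs w T)"
            using fin TU by (intro card_mono finite_nbrs) (auto intro: finite_subset)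
          then show ?thesis using four(4) wT by fastforce
        qed
      qed (use four sub in auto)
    qed
  qed
qed

section \<open>From lists of moves to recolouring sequences\<close>

text \<open>Moves to the present colour are dropped, because \<open>recoloring_step\<close> demands
  a change of colour.\<close>

fun colorings :: "('a \<Rightarrow> 'c) \<Rightarrow> ('a \<times> 'c) list \<Rightarrow> ('a \<Rightarrow> 'c) list" where
  "colorings \<phi> [] = [\<phi>]"
| "colorings \<phi> ((v, c) # ms) = (if \<phi> v = c then colorings \<phi> ms else \<phi> # colorings (\<phi>(v := c)) ms)"

lemma colorings_ends: "colorings \<phi> ms \<noteq> [] \<and> hd (colorings \<phi> ms) = \<phi> \<and> last (colorings \<phi> ms) = run \<phi> ms"
proof (induction \<phi> ms rule: colorings.induct)
  case (2 \<phi> v c ms)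
  then show ?case by (cases "\<phi> v = c") (auto simp: fun_upd_idem simp del: fun_upd_apply)
qed simp

lemma successively_colorings:
  assumes "valid V \<phi> ms" "\<And>\<psi>. proper V \<psi> \<Longrightarrow> \<psi> \<in> extensional V \<Longrightarrow> L_coloring V E L \<psi>"
    "\<phi> \<in> extensional V"
  shows "successively (recoloring_step V E L) (colorings \<phi> ms)"
  using assms(1,3)
proof (induction \<phi> ms rule: colorings.induct)
  case (2 \<phi> v c ms)
  show ?case
  proof (cases "\<phi> v = c")
    case True
    then show ?thesis using 2 by (auto simp: fun_upd_idem)
  next
    case False
    have v: "valid V (\<phi>(v := c)) ms" "v \<in> V" "proper V \<phi>" using 2 by auto
    have e: "\<phi>(v := c) \<in> extensional V" using 2 v by (auto simp: extensional_def)
    have "recoloring_step V E L \<phi> (\<phi>(v := c))"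
      unfolding recoloring_step_def using assms(2) v e 2(4) False valid_proper[OF v(1)] by metis
    then show ?thesis using 2(2)[OF False v(1) e] False colorings_ends[of "\<phi>(v := c)" ms]
      by (cases "colorings (\<phi>(v := c)) ms") (auto simp del: fun_upd_apply)
  qed
qed simp

lemma times_recolored_Cons:
  assumes "\<phi>s \<noteq> []"
  shows "times_recolored (\<phi> # \<phi>s) v \<le> times_recolored \<phi>s v + (if hd \<phi>s v \<noteq> \<phi> v then 1 else 0)"
proof -
  let ?I = "\<lambda>\<phi>s. {i. Suc i < length \<phi>s \<and> (\<phi>s ! Suc i) v \<noteq> (\<phi>s ! i) v}"
  have fin: "finite (?I \<phi>s)" by (rule finite_subset[of _ "{..<length \<phi>s}"]) auto
  have "?I (\<phi> # \<phi>s) \<subseteq> Suc ` ?I \<phi>s \<union> (if hd \<phi>s v \<noteq> \<phi> v then {0} else {})"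
  proof
    fix i assume i: "i \<in> ?I (\<phi> # \<phi>s)"
    show "i \<in> Suc ` ?I \<phi>s \<union> (if hd \<phi>s v \<noteq> \<phi> v then {0} else {})"
      using i assms by (cases i) (auto simp: hd_conv_nth)
  qed
  then have "card (?I (\<phi> # \<phi>s)) \<le> card (Suc ` ?I \<phi>s \<union> (if hd \<phi>s v \<noteq> \<phi> v then {0} else {}))"
    by (rule card_mono[rotated]) (use fin in auto)
  also have "\<dots> \<le> card (Suc ` ?I \<phi>s) + card (if hd \<phi>s v \<noteq> \<phi> v then {0::nat} else {})" by (rule card_Un_le)
  also have "card (Suc ` ?I \<phi>s) = card (?I \<phi>s)" by (simp add: card_image)
  finally show ?thesis unfolding times_recolored_def by (auto split: if_splits)
qed

lemma times_recolored_colorings: "times_recolored (colorings \<phi> ms) v \<le> moves v ms"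
proof (induction \<phi> ms rule: colorings.induct)
  case (1 \<phi>)
  then show ?case by (simp add: times_recolored_def)
next
  case (2 \<phi> x c ms)
  show ?case
  proof (cases "\<phi> x = c")
    case True
    then show ?thesis using 2 by auto
  next
    case False
    then show ?thesis
      using 2(2)[OF False] times_recolored_Cons[of "colorings (\<phi>(x := c)) ms" \<phi> v] colorings_ends[of "\<phi>(x := c)" ms]
      by (auto simp del: fun_upd_apply split: if_splits) (auto split: if_splits)
  qed
qed

end

text \<open>The common source of both claims of the theorem: only the number of edges inside vertex
  subsets enters.\<close>

lemma sparse_recoloring:
  fixes V :: "'a set" and E :: "'a set set" and L :: "'a \<Rightarrow> 'c set"
  assumes G: "simple_graph V E" "finite V" and L: "list_assignment 6 V L"
    and \<alpha>: "L_coloring V E L \<alpha>" and \<beta>: "L_coloring V E L \<beta>"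
    and sparse: "\<And>X. X \<subseteq> V \<Longrightarrow> X \<noteq> {} \<Longrightarrow> 10 * card {e \<in> E. e \<subseteq> X} < 17 * card X"
  shows "\<exists>\<phi>s. recoloring_sequence V E L \<phi>s \<and> transforms \<phi>s \<alpha> \<beta> \<and>
    (\<forall>v\<in>V. times_recolored \<phi>s v \<le> 12)"
proof -
  have two: "card e = 2" "e \<subseteq> V" if "e \<in> E" for e using G that by (auto simp: simple_graph_def)
  interpret list_graph E L
    by unfold_locales (use two in fastforce)
  have col: "L_coloring V E L \<psi> \<longleftrightarrow> proper V \<psi> \<and> \<psi> \<in> extensional V" for \<psi>
    using two(2) unfolding L_coloring_def proper_def PiE_iff by blast
  have "recolorable V"
    by (rule recolorable_if_sparse[OF G(2) two(1) _ sparse]) (use L in \<open>auto simp: list_assignment_def\<close>)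
  then obtain ms where ms: "valid V \<alpha> ms" "\<forall>u\<in>V. run \<alpha> ms u = \<beta> u" "\<forall>u\<in>V. moves u ms \<le> 12"
    using \<alpha> \<beta> unfolding recolorable_def col by blast
  \<comment> \<open>Moves concern \<open>V\<close> only, and both colourings are
    \<open>undefined\<close> elsewhere; so agreement on \<open>V\<close> becomes equality of
    functions.\<close>
  have "run \<alpha> ms u = \<beta> u" for u
  proof (cases "u \<in> V")
    case False
    then show ?thesis using run_outside[of u ms \<alpha>] fst_valid_subset[OF ms(1)] \<alpha> \<beta> col
      by (auto simp: extensional_def)
  qed (use ms in auto)
  then have "run \<alpha> ms = \<beta>" by auto
  then show ?thesis
    using colorings_ends[of \<alpha> ms] successively_colorings[OF ms(1)] \<alpha> col ms(3) times_recolored_colorings[of \<alpha> ms]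
    unfolding recoloring_sequence_def transforms_def
    by (intro exI[of _ "colorings \<alpha> ms"]) (auto intro: order_trans)
qed

text \<open>The induced subgraph on \<open>X\<close> competes in the maximum defining
  \<open>mad\<close>; finiteness of the set of competing values makes \<open>Max\<close> an upper
  bound.\<close>

lemma sparse_if_mad_less:
  assumes "finite V" "simple_graph V E" "mad V E < 17 / 5" and X: "X \<subseteq> V" "X \<noteq> {}"
  shows "10 * card {e \<in> E. e \<subseteq> X} < 17 * card X"
proof -
  let ?S = "{2 * real (card F) / real (card W) | W F. subgraph W F V E \<and> W \<noteq> {}}"
  have "E \<subseteq> Pow V" using assms(2) by (auto simp: simple_graph_def)
  then have finE: "finite E" using assms(1) finite_subset by auto
  have "?S \<subseteq> (\<lambda>(W, F). 2 * real (card F) / real (card W)) ` (Pow V \<times> Pow E)"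
    by (auto simp: subgraph_def)
  then have fin: "finite ?S" by (rule finite_subset) (use assms(1) finE in auto)
  have "2 * real (card {e \<in> E. e \<subseteq> X}) / real (card X) \<in> ?S"
    using X assms(2) by (auto simp: subgraph_def simple_graph_def intro!: exI[of _ X])
  then have "2 * real (card {e \<in> E. e \<subseteq> X}) / real (card X) \<le> mad V E"
    using fin X unfolding mad_def by auto
  then have "2 * real (card {e \<in> E. e \<subseteq> X}) / real (card X) < 17 / 5" using assms(3) by simp
  moreover have "0 < real (card X)" using X assms(1) finite_subset by (auto simp: card_gt_0_iff)
  ultimately have "10 * real (card {e \<in> E. e \<subseteq> X}) < 17 * real (card X)" by (simp add: field_simps)
  then show ?thesis by linarith
qed

section \<open>Plane graphs of girth at least 5\<close>

fun path_edges :: "'a list \<Rightarrow> 'a set set" where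
  "path_edges (x # y # zs) = insert {x, y} (path_edges (y # zs))"
| "path_edges _ = {}"

text \<open>These are exactly the edges that lie on a cycle, since a rotation of the list turns any
  edge of a cycle into its closing edge.\<close>

definition closes :: "'a set set \<Rightarrow> 'a set \<Rightarrow> bool" where
  "closes F e \<longleftrightarrow> (\<exists>xs. cycle F xs \<and> e = {last xs, hd xs})"

definition acyclic_graph :: "'a set set \<Rightarrow> bool" where
  "acyclic_graph F \<longleftrightarrow> (\<forall>xs. \<not> cycle F xs)"

lemma cycle_mono: "cycle F xs \<Longrightarrow> F \<subseteq> E \<Longrightarrow> cycle E xs"
  unfolding cycle_def by (auto elim: successively_mono)

lemma closes_mono: "closes F e \<Longrightarrow> F \<subseteq> E \<Longrightarrow> closes E e"
  unfolding closes_def using cycle_mono by blast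

lemma acyclic_graph_mono: "acyclic_graph E \<Longrightarrow> F \<subseteq> E \<Longrightarrow> acyclic_graph F"
  unfolding acyclic_graph_def using cycle_mono by blast

lemma path_edges_subset: "e \<in> path_edges xs \<Longrightarrow> e \<subseteq> set xs"
  by (induction xs rule: path_edges.induct) auto

lemma successively_path_edges: "successively (\<lambda>u v. {u, v} \<in> F) xs \<longleftrightarrow> path_edges xs \<subseteq> F"
  by (induction xs rule: path_edges.induct) auto

lemma finite_path_edges: "finite (path_edges xs)"
  by (induction xs rule: path_edges.induct) auto

lemma card_path_edges: "distinct xs \<Longrightarrow> card (path_edges xs) = length xs - 1"
proof (induction xs rule: path_edges.induct)
  case (1 x y zs)
  have "{x, y} \<notin> path_edges (y # zs)" using path_edges_subset 1(2) by fastforce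
  then show ?case using 1 finite_path_edges[of "y # zs"] by simp
qed auto

lemma path_edges_split:
  "e \<in> path_edges xs \<Longrightarrow> \<exists>as bs. xs = as @ bs \<and> as \<noteq> [] \<and> bs \<noteq> [] \<and> e = {last as, hd bs}"
proof (induction xs rule: path_edges.induct)
  case (1 x y zs)
  show ?case
  proof (cases "e = {x, y}")
    case True
    then show ?thesis by (intro exI[of _ "[x]"] exI[of _ "y # zs"]) auto
  next
    case False
    then obtain as bs where "y # zs = as @ bs" "as \<noteq> []" "bs \<noteq> []" "e = {last as, hd bs}"
      using 1 by auto
    then show ?thesis by (intro exI[of _ "x # as"] exI[of _ bs]) auto
  qed
qed auto

text \<open>Cutting the list at an occurrence of the closing edge would give two pieces with their
  ends identified crosswise; distinctness makes each piece a single vertex, so the list would have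
  length 2. Thus a cycle has as many edges as vertices.\<close>

lemma closing_edge_not_in_path_edges:
  assumes "distinct xs" "3 \<le> length xs"
  shows "{last xs, hd xs} \<notin> path_edges xs"
proof
  assume "{last xs, hd xs} \<in> path_edges xs"
  then obtain as bs where *: "xs = as @ bs" "as \<noteq> []" "bs \<noteq> []" "{last xs, hd xs} = {last as, hd bs}"
    using path_edges_split by metis
  have dj: "set as \<inter> set bs = {}" using assms(1) * by auto
  have "last bs \<in> set bs" "hd as \<in> set as" "last as \<in> set as" "hd bs \<in> set bs" using * by auto
  moreover from this have "last bs \<noteq> last as" using dj by auto
  ultimately have "hd as = last as" "hd bs = last bs" using * by (auto simp: doubleton_eq_iff)
  moreover have "distinct as" "distinct bs" using assms(1) * by auto
  ultimately have "length as = 1" "length bs = 1"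
    using *(2,3) last_in_set[of "tl as"] last_in_set[of "tl bs"]
    by (cases as; cases bs; auto split: if_splits)+
  then show False using assms(2) * by simp
qed

lemma cycle_closing_edges:
  assumes "cycle F xs"
  obtains S where "S \<subseteq> F" "finite S" "card S = length xs" "\<And>e. e \<in> S \<Longrightarrow> closes F e"
proof -
  define S where "S = insert {last xs, hd xs} (path_edges xs)"
  have xs: "3 \<le> length xs" "distinct xs" "path_edges xs \<subseteq> F" "{last xs, hd xs} \<in> F"
    using assms successively_path_edges unfolding cycle_def by auto
  have "closes F e" if e: "e \<in> path_edges xs" for e
  proof -
    obtain as bs where *: "xs = as @ bs" "as \<noteq> []" "bs \<noteq> []" "e = {last as, hd bs}"
      using path_edges_split[OF e] by blast
    have "cycle F (bs @ as)" using assms * unfolding cycle_def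
      by (auto simp: successively_append_iff)
    moreover have "e = {last (bs @ as), hd (bs @ as)}" using * by simp
    ultimately show ?thesis unfolding closes_def by blast
  qed
  then have "closes F e" if "e \<in> S" for e using that assms unfolding S_def closes_def by auto
  moreover have "card S = length xs"
    using closing_edge_not_in_path_edges[OF xs(2,1)] card_path_edges[OF xs(2)] finite_path_edges[of xs] xs(1)
    unfolding S_def by simp
  ultimately show ?thesis using that[of S] xs finite_path_edges[of xs] unfolding S_def by auto
qed

text \<open>An end of a longest path is a leaf.\<close>

lemma acyclic_graph_leaf:
  assumes G: "simple_graph V F" "finite V" and "acyclic_graph F" "F \<noteq> {}"
  obtains u v where "u \<noteq> v" "{u, v} \<in> F" "\<And>w. {v, w} \<in> F \<Longrightarrow> w = u"
proof -
  define P where "P xs \<longleftrightarrow> distinct xs \<and> successively (\<lambda>u v. {u, v} \<in> F) xs \<and> set xs \<subseteq> V \<and> 2 \<le> length xs" for xs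
  obtain e where e: "e \<in> F" using assms(4) by auto
  then obtain x y where xy: "e = {x, y}" "x \<noteq> y" "x \<in> V" "y \<in> V"
    using G by (auto simp: simple_graph_def card_2_iff)
  have "P [x, y]" using xy e by (auto simp: P_def)
  moreover have "length xs \<le> card V" if "P xs" for xs
    using that G card_mono[of V "set xs"] distinct_card[of xs] by (auto simp: P_def)
  ultimately obtain xs where xs: "P xs" "\<And>ys. P ys \<Longrightarrow> length ys \<le> length xs"
    using ex_has_greatest_nat[of P "[x, y]" length "Suc (card V)"] le_imp_less_Suc by blast
  then obtain v u zs where vu: "xs = v # u # zs"
    by (cases xs rule: path_edges.cases) (auto simp: P_def)
  have "w = u" if w: "{v, w} \<in> F" for w
  proof (rule ccontr)
    assume "w \<noteq> u"
    have wV: "w \<in> V" "w \<noteq> v" using w G by (auto simp: simple_graph_def)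
    show False
    proof (cases "w \<in> set xs")
      case False
      then have "P (w # xs)" using xs(1) w wV vu by (auto simp: P_def insert_commute)
      then show False using xs(2) by fastforce
    next
      case True
      then obtain as bs where *: "xs = as @ w # bs" by (meson split_list)
      have "3 \<le> length (as @ [w])" using * vu wV \<open>w \<noteq> u\<close>
        by (cases as rule: path_edges.cases) auto
      moreover have "hd (as @ [w]) = v" using * vu wV by (cases as) auto
      moreover have "successively (\<lambda>u v. {u, v} \<in> F) (as @ [w])"
        using xs(1) * unfolding P_def by (auto simp: successively_append_iff)
      moreover have "distinct (as @ [w])" using xs(1) * unfolding P_def by auto
      ultimately have "cycle F (as @ [w])" using w unfolding cycle_def by (simp add: insert_commute)
      then show False using assms(3) by (auto simp: acyclic_graph_def)
    qed
  qed
  moreover have "u \<noteq> v" "{u, v} \<in> F" using xs(1) vu by (auto simp: P_def insert_commute)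
  ultimately show ?thesis using that by blast
qed

lemma acyclic_graph_delete_leaf:
  assumes "simple_graph V F" "\<And>w. {v, w} \<in> F \<Longrightarrow> w = u"
  shows "simple_graph (V - {v}) (F - {{u, v}})"
  unfolding simple_graph_def
proof
  fix e assume e: "e \<in> F - {{u, v}}"
  then have "card e = 2" "e \<subseteq> V" using assms(1) by (auto simp: simple_graph_def)
  moreover have "v \<notin> e"
  proof
    assume "v \<in> e"
    then obtain w where "e = {v, w}" using \<open>card e = 2\<close> by (auto simp: card_2_iff)
    then show False using e assms(2)[of w] by (auto simp: insert_commute)
  qed
  ultimately show "e \<subseteq> V - {v} \<and> card e = 2" by auto
qed

text \<open>Deleting a leaf removes one vertex and one edge. The sharper bound for forests would
  only improve the additive constant in \<open>euler_inequality\<close>.\<close>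

lemma card_acyclic_graph:
  assumes "simple_graph V F" "finite V" "acyclic_graph F"
  shows "card F \<le> card V"
  using assms
proof (induction "card V" arbitrary: V F rule: less_induct)
  case less
  show ?case
  proof (cases "F = {}")
    case False
    obtain u v where uv: "u \<noteq> v" "{u, v} \<in> F" "\<And>w. {v, w} \<in> F \<Longrightarrow> w = u"
      using acyclic_graph_leaf[OF less.prems False] by blast
    have vV: "v \<in> V" using uv(2) less.prems(1) by (auto simp: simple_graph_def)
    have "F \<subseteq> Pow V" using less.prems(1) by (auto simp: simple_graph_def)
    then have "finite F" using less.prems(2) finite_subset by auto
    have "card (F - {{u, v}}) \<le> card (V - {v})"
      by (rule less.hyps[OF _ acyclic_graph_delete_leaf[OF less.prems(1) uv(3)]])
        (use vV less.prems(2) acyclic_graph_mono[OF less.prems(3)] card_Diff1_less[OF less.prems(2) vV] in auto)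
    moreover have "card F = Suc (card (F - {{u, v}}))" "card V = Suc (card (V - {v}))"
      using card.remove[OF \<open>finite F\<close> uv(2)] card.remove[OF less.prems(2) vV] by simp_all
    ultimately show ?thesis by simp
  qed simp
qed

section \<open>Drawings, arcs and closed curves\<close>

locale plane_graph =
  fixes V :: "'a set" and E :: "'a set set" and p :: "'a \<Rightarrow> complex"
    and \<gamma> :: "'a set \<Rightarrow> real \<Rightarrow> complex"
  assumes graph: "simple_graph V E" "finite V" and draw: "plane_drawing V E p \<gamma>"
begin

text \<open>All vertices of \<open>W\<close> belong to the drawing, also isolated ones; with
  \<open>W = V\<close>, deleting an edge removes precisely its \<open>rim\<close>.\<close>

definition drawing :: "'a set \<Rightarrow> 'a set set \<Rightarrow> complex set" where
  "drawing W F = p ` W \<union> (\<Union>e\<in>F. path_image (\<gamma> e))"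

definition rim :: "'a set \<Rightarrow> complex set" where
  "rim e = path_image (\<gamma> e) - p ` e"

text \<open>With \<open>rim\<close> instead of the whole arc, a face that reaches an edge only at an
  end vertex does not count.\<close>

definition touches :: "complex set \<Rightarrow> 'a set \<Rightarrow> bool" where
  "touches C e \<longleftrightarrow> closure C \<inter> rim e \<noteq> {}"

lemma edge: "e \<in> E \<Longrightarrow> e \<subseteq> V" "e \<in> E \<Longrightarrow> card e = 2"
  using graph by (auto simp: simple_graph_def)

lemma finite_E: "finite E"
  by (rule finite_subset[of E "Pow V"]) (use edge graph in auto)

lemma inj_p: "inj_on p V"
  using draw by (auto simp: plane_drawing_def)

lemma arc_\<gamma>: "e \<in> E \<Longrightarrow> arc (\<gamma> e)" "e \<in> E \<Longrightarrow> {pathstart (\<gamma> e), pathfinish (\<gamma> e)} = p ` e"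
  using draw by (auto simp: plane_drawing_def)

lemma ends_\<gamma>: assumes "e \<in> E" shows "p ` e \<subseteq> path_image (\<gamma> e)"
  unfolding arc_\<gamma>(2)[OF assms, symmetric]
  by (simp add: pathstart_in_path_image pathfinish_in_path_image)

lemma rim_disjoint: "e \<in> E \<Longrightarrow> rim e \<inter> p ` V = {}" "e \<in> E \<Longrightarrow> f \<in> E \<Longrightarrow> f \<noteq> e \<Longrightarrow> rim e \<inter> path_image (\<gamma> f) = {}"
  using draw unfolding plane_drawing_def rim_def by blast+

lemma vertex_on_edge: "e \<in> E \<Longrightarrow> v \<in> V \<Longrightarrow> p v \<in> path_image (\<gamma> e) \<Longrightarrow> v \<in> e"
proof -
  assume *: "e \<in> E" "v \<in> V" "p v \<in> path_image (\<gamma> e)"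
  have "p v \<in> p ` e" using rim_disjoint(1)[OF *(1)] * unfolding rim_def by auto
  then show "v \<in> e" using inj_p edge(1)[OF *(1)] *(2) by (auto simp: inj_on_def)
qed

lemma edges_meet: "e \<in> E \<Longrightarrow> f \<in> E \<Longrightarrow> f \<noteq> e \<Longrightarrow> path_image (\<gamma> e) \<inter> path_image (\<gamma> f) \<subseteq> p ` (e \<inter> f)"
proof
  fix z assume *: "e \<in> E" "f \<in> E" "f \<noteq> e" "z \<in> path_image (\<gamma> e) \<inter> path_image (\<gamma> f)"
  have "z \<in> p ` e" using rim_disjoint(2)[OF *(1-3)] * unfolding rim_def by auto
  then obtain v where v: "v \<in> e" "z = p v" by auto
  then have "v \<in> f" using vertex_on_edge[of f v] * edge(1)[OF *(1)] by auto
  then show "z \<in> p ` (e \<inter> f)" using v by auto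
qed

lemma rim: assumes "e \<in> E" shows "connected (rim e)" "rim e \<noteq> {}"
proof -
  have "simple_path (\<gamma> e)" using arc_\<gamma>(1)[OF assms] by (rule arc_imp_simple_path)
  then show "connected (rim e)" "rim e \<noteq> {}"
    using connected_simple_path_endless[of "\<gamma> e"] nonempty_simple_path_endless[of "\<gamma> e"]
    unfolding rim_def arc_\<gamma>(2)[OF assms, symmetric] by auto
qed

lemma compact_drawing:
  assumes "F \<subseteq> E" "W \<subseteq> V" shows "compact (drawing W F)"
proof -
  have "finite F" "finite W" using assms finite_E graph(2) finite_subset by auto
  then show ?thesis unfolding drawing_def
    by (intro compact_Un compact_UN) (use assms arc_\<gamma>(1) in \<open>auto intro: finite_imp_compact compact_arc_image\<close>)
qed

lemma closed_drawing: "F \<subseteq> E \<Longrightarrow> closed (drawing V F)"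
  using compact_drawing[of F V] compact_imp_closed by auto

lemma edge_arc:
  assumes "{x, y} \<in> E"
  obtains g where "arc g" "pathstart g = p x" "pathfinish g = p y" "path_image g = path_image (\<gamma> {x, y})"
proof -
  have "arc (\<gamma> {x, y})" "{pathstart (\<gamma> {x, y}), pathfinish (\<gamma> {x, y})} = {p x, p y}"
    using arc_\<gamma>[OF assms] by auto
  then consider "arc (\<gamma> {x, y})" "pathstart (\<gamma> {x, y}) = p x" "pathfinish (\<gamma> {x, y}) = p y"
    | "arc (\<gamma> {x, y})" "pathstart (\<gamma> {x, y}) = p y" "pathfinish (\<gamma> {x, y}) = p x"
    by (auto simp: doubleton_eq_iff)
  then show ?thesis
  proof cases
    case 1
    then show ?thesis using that by blast
  next
    case 2
    then show ?thesis using that[of "reversepath (\<gamma> {x, y})"] by (simp add: arc_reversepath)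
  qed
qed

lemma path_arc:
  assumes "distinct xs" "2 \<le> length xs" "path_edges xs \<subseteq> E"
  shows "\<exists>g. arc g \<and> pathstart g = p (hd xs) \<and> pathfinish g = p (last xs) \<and>
    path_image g = (\<Union>e\<in>path_edges xs. path_image (\<gamma> e))"
  using assms
proof (induction xs rule: path_edges.induct)
  case (1 x y zs)
  have xyE: "{x, y} \<in> E" using 1 by auto
  obtain g1 where g1: "arc g1" "pathstart g1 = p x" "pathfinish g1 = p y"
    "path_image g1 = path_image (\<gamma> {x, y})" using edge_arc[OF xyE] by blast
  show ?case
  proof (cases zs)
    case Nil
    then show ?thesis using g1 by auto
  next
    case (Cons z ws)
    then obtain g2 where g2: "arc g2" "pathstart g2 = p y" "pathfinish g2 = p (last (y # zs))"
      "path_image g2 = (\<Union>e\<in>path_edges (y # zs). path_image (\<gamma> e))" using 1 by auto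
    have "path_image (\<gamma> {x, y}) \<inter> path_image (\<gamma> f) \<subseteq> {p y}" if f: "f \<in> path_edges (y # zs)" for f
    proof -
      have "x \<notin> f" using path_edges_subset[OF f] 1(2) by auto
      then show ?thesis using edges_meet[OF xyE, of f] f 1(4) by auto
    qed
    then have "path_image g1 \<inter> path_image g2 \<subseteq> {pathstart g2}" using g1 g2 by auto
    then have "arc (g1 +++ g2)" using g1 g2 by (intro arc_join) auto
    then show ?thesis using g1 g2 by (intro exI[of _ "g1 +++ g2"]) (auto simp: path_image_join)
  qed
qed auto

text \<open>The curve is the cycle of which \<open>e\<close> is an edge. It meets the drawing
  without \<open>e\<close> in the arc formed by the other edges of the cycle; that this arc is
  connected is the hypothesis of Janiszewski's theorem.\<close>

lemma cycle_curve:
  assumes "cycle F xs" "F \<subseteq> E" "e = {last xs, hd xs}"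
  obtains c where "simple_path c" "pathfinish c = pathstart c" "rim e \<subseteq> path_image c"
    "path_image c \<union> drawing V (F - {e}) = drawing V F" "connected (path_image c \<inter> drawing V (F - {e}))"
proof -
  have xs: "3 \<le> length xs" "distinct xs" "path_edges xs \<subseteq> F" "{last xs, hd xs} \<in> F"
    using assms successively_path_edges unfolding cycle_def by auto
  have ne: "xs \<noteq> []" using xs by auto
  have e: "e \<notin> path_edges xs" "e \<in> E" "e \<in> F" using closing_edge_not_in_path_edges[OF xs(2,1)] assms xs by auto
  obtain g where g: "arc g" "pathstart g = p (hd xs)" "pathfinish g = p (last xs)"
    "path_image g = (\<Union>e\<in>path_edges xs. path_image (\<gamma> e))"
    using path_arc[OF xs(2)] xs assms by auto
  obtain h where h: "arc h" "pathstart h = p (last xs)" "pathfinish h = p (hd xs)"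
    "path_image h = path_image (\<gamma> e)" using edge_arc[of "last xs" "hd xs"] e assms by metis
  have "path_image (\<gamma> e) \<inter> path_image (\<gamma> f) \<subseteq> p ` e" if f: "f \<in> path_edges xs" for f
    using edges_meet[OF e(2), of f] f xs(3) assms(2) e(1) by blast
  then have gh: "path_image h \<inter> path_image g \<subseteq> {p (last xs), p (hd xs)}" using g h assms(3) by auto
  show ?thesis
  proof (rule that[of "h +++ g"])
    show "simple_path (h +++ g)" using g h gh by (intro simple_path_join_loop) auto
    show "pathfinish (h +++ g) = pathstart (h +++ g)" using g h by auto
    have im: "path_image (h +++ g) = path_image (\<gamma> e) \<union> path_image g" using g h by (simp add: path_image_join)
    show "rim e \<subseteq> path_image (h +++ g)" unfolding im rim_def by auto
    have sub: "path_image g \<subseteq> drawing V (F - {e})" unfolding g drawing_def using xs(3) e(1) by auto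
    show "path_image (h +++ g) \<union> drawing V (F - {e}) = drawing V F"
      using sub e(3) unfolding im drawing_def by auto
    have "p ` e \<subseteq> path_image g" using g assms(3) pathstart_in_path_image[of g] pathfinish_in_path_image[of g] by auto
    moreover have "path_image (\<gamma> e) \<inter> drawing V (F - {e}) \<subseteq> p ` e"
      using rim_disjoint[OF e(2)] assms(2) unfolding drawing_def rim_def by blast
    ultimately have "path_image (h +++ g) \<inter> drawing V (F - {e}) = path_image g" using sub unfolding im by auto
    then show "connected (path_image (h +++ g) \<inter> drawing V (F - {e}))" using g(1) connected_arc_image by auto
  qed
qed

lemma rim_avoids: "e \<in> E \<Longrightarrow> F \<subseteq> E \<Longrightarrow> rim e \<subseteq> - drawing V (F - {e})"
  using rim_disjoint unfolding drawing_def by blast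

lemma drawing_mono: "F \<subseteq> F' \<Longrightarrow> drawing V F \<subseteq> drawing V F'"
  unfolding drawing_def by auto

section \<open>Faces\<close>

text \<open>A forest arises by attaching leaf edges. The new arc meets the rest only in
  \<open>p u\<close>, so Janiszewski's theorem keeps the complement connected. The vertex set must
  shrink along with the leaf: if \<open>p v\<close> stayed, the intersection would consist of two
  points.\<close>

lemma connected_Compl_acyclic:
  assumes "W \<subseteq> V" "F \<subseteq> E" "simple_graph W F" "acyclic_graph F"
  shows "connected (- drawing W F)"
  using assms
proof (induction "card W" arbitrary: W F rule: less_induct)
  case less
  have finW: "finite W" using less.prems(1) graph(2) finite_subset by auto
  show ?case
  proof (cases "F = {}")
    case True
    have "path_connected (- p ` W)"
      by (rule path_connected_complement_countable) (use finW in \<open>auto intro: countable_finite\<close>)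
    then show ?thesis using True path_connected_imp_connected by (simp add: drawing_def)
  next
    case False
    obtain u v where uv: "u \<noteq> v" "{u, v} \<in> F" "\<And>w. {v, w} \<in> F \<Longrightarrow> w = u"
      using acyclic_graph_leaf[OF less.prems(3) finW less.prems(4) False] by blast
    let ?e = "{u, v}" and ?W = "W - {v}" and ?F = "F - {{u, v}}"
    have uvW: "u \<in> W" "v \<in> W" using uv(2) less.prems(3) by (auto simp: simple_graph_def)
    have eE: "?e \<in> E" using uv less.prems by auto
    have sg: "simple_graph ?W ?F" by (rule acyclic_graph_delete_leaf[OF less.prems(3) uv(3)])
    have c1: "connected (- drawing ?W ?F)"
      by (rule less.hyps[OF _ _ _ sg]) (use less.prems uvW acyclic_graph_mono[OF less.prems(4)] card_Diff1_less[OF finW uvW(2)] in auto)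
    have pv: "p v \<notin> drawing ?W ?F"
    proof
      assume "p v \<in> drawing ?W ?F"
      then consider w where "w \<in> W - {v}" "p v = p w" | f where "f \<in> ?F" "p v \<in> path_image (\<gamma> f)"
        unfolding drawing_def by auto
      then show False
      proof cases
        case 1
        then show False using inj_p uvW less.prems(1) by (auto simp: inj_on_def)
      next
        case 2
        then have "v \<in> f" using vertex_on_edge[of f v] less.prems uvW by auto
        then show False using sg 2 by (auto simp: simple_graph_def)
      qed
    qed
    have "path_image (\<gamma> ?e) \<inter> drawing ?W ?F \<subseteq> p ` ?e"
      using rim_disjoint[OF eE] less.prems unfolding drawing_def rim_def by blast
    moreover have "p u \<in> path_image (\<gamma> ?e) \<inter> drawing ?W ?F"
      using ends_\<gamma>[OF eE] uv(1) uvW unfolding drawing_def by auto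
    ultimately have "path_image (\<gamma> ?e) \<inter> drawing ?W ?F = {p u}" using pv by auto
    then have "connected (- (path_image (\<gamma> ?e) \<union> drawing ?W ?F))"
      using arc_\<gamma>(1)[OF eE] c1 compact_drawing[of ?F ?W] less.prems
      by (intro Janiszewski_connected)
        (auto intro: compact_arc_image compact_imp_closed connected_arc_complement)
    moreover have "path_image (\<gamma> ?e) \<union> drawing ?W ?F = drawing W F"
      using uv(2) uvW ends_\<gamma>[OF eE] unfolding drawing_def by auto
    ultimately show ?thesis by simp
  qed
qed

text \<open>If the edges touching \<open>C\<close> formed a forest, its drawing would have a
  connected complement. In it \<open>C\<close> is open, and also closed because the frontier of
  \<open>C\<close> lies on vertices and touching edges; so \<open>C\<close> is the whole complement.
  As \<open>C\<close> avoids every edge of \<open>F\<close>, all these edges would belong to the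
  forest, and \<open>F\<close> would be acyclic.\<close>

lemma face_cycle:
  assumes F: "F \<subseteq> E" "\<not> acyclic_graph F" and C: "C \<in> components (- drawing V F)"
  shows "\<not> acyclic_graph {e \<in> F. touches C e}"
proof
  let ?F = "{e \<in> F. touches C e}"
  let ?K = "drawing V ?F"
  assume ac: "acyclic_graph ?F"
  have "simple_graph V ?F" using graph F by (auto simp: simple_graph_def)
  then have con: "connected (- ?K)" using connected_Compl_acyclic[of V ?F] ac F by auto
  have CD: "C \<subseteq> - drawing V F" "C \<noteq> {}" using C in_components_subset in_components_nonempty by auto
  have CK: "C \<subseteq> - ?K" using CD drawing_mono[of ?F F] by auto
  have "frontier C \<subseteq> ?K"
  proof
    fix z assume z: "z \<in> frontier C"
    then have "z \<in> drawing V F"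
      using frontier_of_components_closed_complement[OF closed_drawing[OF F(1)] C] by auto
    then consider "z \<in> p ` V" | e where "e \<in> F" "z \<in> path_image (\<gamma> e)" unfolding drawing_def by auto
    then show "z \<in> ?K"
    proof cases
      case 1
      then show ?thesis unfolding drawing_def by auto
    next
      case 2
      show ?thesis
      proof (cases "z \<in> p ` e")
        case True
        then show ?thesis using edge(1)[of e] 2 F unfolding drawing_def by auto
      next
        case False
        then have "touches C e" using 2 z unfolding touches_def rim_def frontier_def by auto
        then show ?thesis using 2 unfolding drawing_def by auto
      qed
    qed
  qed
  then have "closure C \<inter> - ?K = C" using CK closure_Un_frontier[of C] by auto
  then have "closedin (top_of_set (- ?K)) C" by (metis closed_closure closedin_closed inf_commute)
  moreover have "open C" using open_components[OF _ C] closed_drawing[OF F(1)] by auto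
  then have "openin (top_of_set (- ?K)) C" using CK by (auto intro: open_openin_trans openin_open_Int simp: openin_open)
  ultimately have CK: "C = - ?K" using con CD(2) unfolding connected_clopen by auto
  have "F \<subseteq> ?F"
  proof
    fix e assume e: "e \<in> F"
    obtain w where w: "w \<in> rim e" using rim(2)[of e] e F by auto
    then have "w \<in> drawing V F" using e unfolding rim_def drawing_def by auto
    then have "w \<in> ?K" using CK CD by auto
    then obtain f where f: "f \<in> ?F" "w \<in> path_image (\<gamma> f)"
      using w rim_disjoint(1)[of e] e F unfolding drawing_def by auto
    then have "f = e" using rim_disjoint(2)[of e f] w e F by blast
    then show "e \<in> ?F" using f by simp
  qed
  then show False using ac F(2) acyclic_graph_mono by blast
qed

lemma connected_subset_either:
  assumes "connected C" "C \<subseteq> S \<union> T" "S \<inter> T = {}" "open S" "open T"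
  shows "C \<subseteq> S \<or> C \<subseteq> T"
  using connectedD[OF assms(1,4,5)] assms(2,3) by blast

lemma component_unique:
  assumes "A \<in> components S" "B \<in> components S" "x \<in> A" "y \<in> B" "connected_component S x y"
  shows "A = B"
  using assms by (metis componentsE connected_component_eq mem_Collect_eq)

text \<open>Each face lies inside or outside the curve \<open>c\<close> of a cycle through
  \<open>e\<close>. Two faces touching \<open>e\<close> are joined through \<open>rim e\<close> off
  the rest of the drawing; if they lie on the same side, they are also joined off \<open>c\<close>.
  Janiszewski's theorem then joins them off the whole drawing, so they are equal. Hence the side
  determines the face.\<close>

lemma closing_edge_faces:
  assumes F: "F \<subseteq> E" and e: "closes F e"
    and \<Phi>: "\<Phi> \<subseteq> {C \<in> components (- drawing V F). touches C e}"
  shows "card \<Phi> \<le> 2"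
proof -
  obtain xs where xs: "cycle F xs" "e = {last xs, hd xs}" using e unfolding closes_def by auto
  have eE: "e \<in> E" using xs F unfolding cycle_def by auto
  let ?K = "drawing V (F - {e})"
  obtain c where c: "simple_path c" "pathfinish c = pathstart c" "rim e \<subseteq> path_image c"
    "path_image c \<union> ?K = drawing V F" "connected (path_image c \<inter> ?K)"
    using cycle_curve[OF xs(1) F xs(2)] by blast
  have J: "inside (path_image c) \<inter> outside (path_image c) = {}"
    "inside (path_image c) \<union> outside (path_image c) = - path_image c"
    "open (inside (path_image c))" "open (outside (path_image c))"
    "connected (inside (path_image c))" "connected (outside (path_image c))"
    using Jordan_inside_outside[OF c(1,2)] by simp_all
  have side: "C \<subseteq> inside (path_image c) \<or> C \<subseteq> outside (path_image c)"
    if "C \<in> components (- drawing V F)" for C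
  proof -
    have "connected C" "C \<subseteq> - path_image c" using that in_components_connected in_components_subset c(4) by blast+
    then show ?thesis using J by (intro connected_subset_either) auto
  qed
  have eq: "A = B" if AB: "A \<in> \<Phi>" "B \<in> \<Phi>"
    and S: "A \<subseteq> S" "B \<subseteq> S" "connected S" "S \<subseteq> - path_image c" for A B S
  proof -
    have A: "A \<in> components (- drawing V F)" "touches A e" and B: "B \<in> components (- drawing V F)" "touches B e"
      using AB \<Phi> by auto
    obtain x y where x: "x \<in> A" and y: "y \<in> B" using A B in_components_nonempty by blast
    have DK: "- drawing V F \<subseteq> - ?K" using drawing_mono[of "F - {e}" F] by auto
    have T: "connected (C \<union> rim e)" "C \<union> rim e \<subseteq> - ?K" if C: "C \<in> components (- drawing V F)" "touches C e" for C
    proof -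
      obtain z where z: "z \<in> closure C" "z \<in> rim e" using C unfolding touches_def by auto
      have "connected (insert z C)"
        by (rule connected_intermediate_closure[of C]) (use C z closure_subset in_components_connected in auto)
      then have "connected (insert z C \<union> rim e)" using rim(1)[OF eE] z by (intro connected_Un) auto
      then show "connected (C \<union> rim e)" using z by (simp add: insert_absorb)
      show "C \<union> rim e \<subseteq> - ?K" using C(1) in_components_subset DK rim_avoids[OF eE F] by blast
    qed
    have "connected ((A \<union> rim e) \<union> (B \<union> rim e))"
      by (rule connected_Un[OF T(1)[OF A] T(1)[OF B]]) (use rim(2)[OF eE] in blast)
    then have "connected_component (- ?K) x y"
      unfolding connected_component_def using T(2)[OF A] T(2)[OF B] x y
      by (intro exI[of _ "(A \<union> rim e) \<union> (B \<union> rim e)"]) auto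
    moreover have "connected_component (- path_image c) x y"
      unfolding connected_component_def using S x y by blast
    moreover have "compact (path_image c)" using c(1) by (simp add: compact_simple_path_image)
    moreover have "closed ?K" using closed_drawing[of "F - {e}"] F by auto
    ultimately have "connected_component (- (path_image c \<union> ?K)) x y" using c(5) by (intro Janiszewski) auto
    then show ?thesis using component_unique[OF A(1) B(1) x y] c(4) by simp
  qed
  have "inj_on (\<lambda>C. C \<subseteq> inside (path_image c)) \<Phi>"
  proof (rule inj_onI)
    fix A B assume AB: "A \<in> \<Phi>" "B \<in> \<Phi>" "(A \<subseteq> inside (path_image c)) = (B \<subseteq> inside (path_image c))"
    show "A = B"
    proof (cases "A \<subseteq> inside (path_image c)")
      case True
      then show ?thesis using eq[OF AB(1,2), of "inside (path_image c)"] AB(3) J(2,5) by blast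
    next
      case False
      then have "A \<subseteq> outside (path_image c)" "B \<subseteq> outside (path_image c)" using side AB \<Phi> by blast+
      then show ?thesis using eq[OF AB(1,2), of "outside (path_image c)"] J(2,6) by blast
    qed
  qed
  then have "card \<Phi> \<le> card (UNIV :: bool set)" by (rule card_inj_on_le) auto
  then show ?thesis by (simp add: UNIV_bool)
qed

text \<open>The face \<open>H\<close> that contains \<open>rim e\<close> after the deletion
  contained at least two faces before, one on each side of the cycle; all other faces survive
  unchanged.\<close>

lemma faces_delete_closing_edge:
  assumes F: "F \<subseteq> E" and e: "closes F e" and fin: "finite (components (- drawing V F))"
  shows "card (components (- drawing V (F - {e}))) + 1 \<le> card (components (- drawing V F))"
proof -
  obtain xs where xs: "cycle F xs" "e = {last xs, hd xs}" using e unfolding closes_def by auto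
  have eE: "e \<in> E" using xs F unfolding cycle_def by auto
  let ?K = "drawing V (F - {e})" and ?D = "drawing V F"
  obtain c where c: "simple_path c" "pathfinish c = pathstart c" "rim e \<subseteq> path_image c"
    "path_image c \<union> ?K = ?D"
    by (rule cycle_curve[OF xs(1) F xs(2)])
  have J: "inside (path_image c) \<inter> outside (path_image c) = {}"
    "inside (path_image c) \<union> outside (path_image c) = - path_image c"
    "open (inside (path_image c))" "open (outside (path_image c))"
    "frontier (inside (path_image c)) = path_image c" "frontier (outside (path_image c)) = path_image c"
    using Jordan_inside_outside[OF c(1,2)] by simp_all
  have DK: "?D = ?K \<union> rim e"
  proof
    have "e \<in> F" using xs unfolding cycle_def by auto
    then show "?K \<union> rim e \<subseteq> ?D" unfolding drawing_def rim_def by blast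
    have "p ` e \<subseteq> p ` V" using edge(1)[OF eE] by blast
    then show "?D \<subseteq> ?K \<union> rim e" unfolding drawing_def rim_def by blast
  qed
  obtain z where z: "z \<in> rim e" using rim(2)[OF eE] by auto
  define H where "H = connected_component_set (- ?K) z"
  have zK: "z \<in> - ?K" using z rim_avoids[OF eE F] by auto
  have H: "H \<in> components (- ?K)" using zK H_def by (simp add: componentsI)
  have zH: "z \<in> H" using zK H_def by (simp add: connected_component_refl)
  have openH: "open H" using open_components[OF _ H] closed_drawing[of "F - {e}"] F by auto
  have rimH: "rim e \<subseteq> H"
    unfolding H_def by (rule connected_component_maximal) (use z rim(1)[OF eE] rim_avoids[OF eE F] in auto)
  have HK: "H \<subseteq> - ?K" using H in_components_subset by auto
  \<comment> \<open>The point \<open>z\<close> lies in the open set \<open>H\<close> and, by the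
    Jordan curve theorem, on the frontier of either side \<open>S\<close>; so \<open>H\<close> meets
    \<open>S\<close>, and a face through a common point stays in both.\<close>
  have pt: "\<exists>C. C \<in> components (- ?D) \<and> C \<subseteq> H \<and> C \<subseteq> S"
    if S: "S \<inter> T = {}" "S \<union> T = - path_image c" "frontier S = path_image c" "open S" "open T" for S T
  proof -
    have "z \<in> closure S" using S(3) c(3) z frontier_def by blast
    then obtain x where x: "x \<in> H" "x \<in> S" using open_Int_closure_eq_empty[OF openH, of S] zH by blast
    have xD: "x \<in> - ?D" using x S(2) HK c(4) by blast
    define C where "C = connected_component_set (- ?D) x"
    have C: "C \<in> components (- ?D)" "x \<in> C" "connected C" "C \<subseteq> - ?D"
      using xD C_def by (auto simp: componentsI connected_component_refl connected_component_subset)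
    have "C \<subseteq> H" by (rule components_maximal[OF H C(3)]) (use C DK x in auto)
    moreover have "C \<subseteq> S"
      using connected_subset_either[OF C(3) _ S(1,4,5)] C(2,4) S(1,2) c(4) x by blast
    ultimately show ?thesis using C by blast
  qed
  obtain A where A: "A \<in> components (- ?D)" "A \<subseteq> H" "A \<subseteq> inside (path_image c)"
    using pt[OF J(1,2,5,3,4)] by blast
  obtain B where B: "B \<in> components (- ?D)" "B \<subseteq> H" "B \<subseteq> outside (path_image c)"
    using pt[of "outside (path_image c)" "inside (path_image c)"] J by (auto simp: Int_commute Un_commute)
  have other: "C \<in> components (- ?D) \<and> C \<inter> H = {}" if C: "C \<in> components (- ?K)" "C \<noteq> H" for C
  proof
    show CH: "C \<inter> H = {}" using components_nonoverlap[OF C(1) H] C(2) by auto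
    have "C \<subseteq> - ?D" using C(1) in_components_subset CH rimH DK by blast
    then show "C \<in> components (- ?D)" using C(1) DK by (intro components_intermediate_subset[OF C(1)]) auto
  qed
  have neAB: "A \<noteq> {}" "B \<noteq> {}" using in_components_nonempty[OF A(1)] in_components_nonempty[OF B(1)] by auto
  have AB: "A \<noteq> B" using A(3) B(3) neAB J(1) by blast
  have sub: "insert A (insert B (components (- ?K) - {H})) \<subseteq> components (- ?D)" using A(1) B(1) other by blast
  have nAB: "A \<notin> components (- ?K) - {H}" "B \<notin> components (- ?K) - {H}"
    using other A(2) B(2) neAB by blast+
  have finK: "finite (components (- ?K) - {H})" by (rule finite_subset[OF _ fin]) (use sub in blast)
  have "card (components (- ?K)) + 1 = card (insert A (insert B (components (- ?K) - {H})))"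
  proof -
    have "finite (components (- ?K))" using finK by simp
    then show ?thesis using AB nAB finK card_Suc_Diff1[OF _ H] by simp
  qed
  also have "\<dots> \<le> card (components (- ?D))" using sub fin by (rule card_mono[rotated])
  finally show ?thesis .
qed

text \<open>Incidences between faces and edges on cycles are counted twice; restricting to edges on
  cycles makes \<open>closing_edge_faces\<close> applicable. The count is done for finite sets of
  faces, because finiteness is itself a consequence: \<open>card F + 1\<close> faces would already
  be too many.\<close>

lemma faces_bound:
  assumes F: "F \<subseteq> E" "\<not> acyclic_graph F" and g: "\<And>xs. cycle E xs \<Longrightarrow> 5 \<le> length xs"
  shows "finite (components (- drawing V F))" "5 * card (components (- drawing V F)) \<le> 2 * card F"
proof -
  have finF: "finite F" using F finite_E finite_subset by auto
  have *: "5 * card \<Phi> \<le> 2 * card F" if \<Phi>: "\<Phi> \<subseteq> components (- drawing V F)" "finite \<Phi>" for \<Phi>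
  proof -
    let ?B = "{e \<in> F. closes F e}"
    have "5 \<le> card {e \<in> ?B. touches C e}" if C: "C \<in> \<Phi>" for C
    proof -
      obtain xs where xs: "cycle {e \<in> F. touches C e} xs"
        using face_cycle[OF F] C \<Phi> unfolding acyclic_graph_def by blast
      obtain S where S: "S \<subseteq> {e \<in> F. touches C e}" "card S = length xs"
        "\<And>e. e \<in> S \<Longrightarrow> closes {e \<in> F. touches C e} e" using cycle_closing_edges[OF xs] by metis
      have "S \<subseteq> {e \<in> ?B. touches C e}" using S(1) closes_mono[OF S(3), of _ F] by auto
      then have "card S \<le> card {e \<in> ?B. touches C e}" using finF by (intro card_mono) auto
      moreover have "5 \<le> length xs" by (rule g[OF cycle_mono[OF xs]]) (use F in auto)
      ultimately show ?thesis using S(2) by simp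
    qed
    then have "5 * card \<Phi> \<le> (\<Sum>C\<in>\<Phi>. card {e \<in> ?B. touches C e})"
      using sum_bounded_below[of \<Phi> 5 "\<lambda>C. card {e \<in> ?B. touches C e}"] by simp
    also have "\<dots> = (\<Sum>C\<in>\<Phi>. \<Sum>e\<in>?B. if touches C e then 1 else 0)"
      using finF by (simp add: sum.If_cases Int_def)
    also have "\<dots> = (\<Sum>e\<in>?B. \<Sum>C\<in>\<Phi>. if touches C e then 1 else 0)" by (rule sum.swap)
    also have "\<dots> = (\<Sum>e\<in>?B. card {C \<in> \<Phi>. touches C e})"
      using \<Phi>(2) by (simp add: sum.If_cases Int_def)
    also have "\<dots> \<le> (\<Sum>e\<in>?B. 2)"
      by (intro sum_mono closing_edge_faces[OF F(1)]) (use \<Phi> in auto)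
    also have "\<dots> \<le> 2 * card F" using card_mono[OF finF, of ?B] by auto
    finally show ?thesis .
  qed
  show "finite (components (- drawing V F))"
  proof (rule ccontr)
    assume "infinite (components (- drawing V F))"
    then obtain \<Phi> where "\<Phi> \<subseteq> components (- drawing V F)" "finite \<Phi>" "card \<Phi> = Suc (card F)"
      using infinite_arbitrarily_large by blast
    then show False using *[of \<Phi>] by simp
  qed
  then show "5 * card (components (- drawing V F)) \<le> 2 * card F" using * by blast
qed

text \<open>Edges on cycles are deleted until a forest remains; each deletion costs one edge and at
  least one face. The girth bound enters through \<open>faces_bound\<close>, which supplies the
  finiteness that makes the number of faces meaningful.\<close>

lemma euler_inequality:
  assumes g: "\<And>xs. cycle E xs \<Longrightarrow> 5 \<le> length xs" and F: "F \<subseteq> E"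
  shows "card F \<le> card V + card (components (- drawing V F))"
  using F
proof (induction "card F" arbitrary: F rule: less_induct)
  case less
  have finF: "finite F" using less.prems finite_E finite_subset by auto
  show ?case
  proof (cases "acyclic_graph F")
    case True
    have "simple_graph V F" using less.prems edge by (auto simp: simple_graph_def)
    then show ?thesis using card_acyclic_graph[OF _ graph(2) True] by simp
  next
    case False
    then obtain xs where xs: "cycle F xs" unfolding acyclic_graph_def by auto
    define e where "e = {last xs, hd xs}"
    have e: "closes F e" "e \<in> F" using xs unfolding closes_def e_def cycle_def by auto
    have "card (F - {e}) \<le> card V + card (components (- drawing V (F - {e})))"
      by (rule less.hyps) (use less.prems card_Diff1_less[OF finF e(2)] in auto)
    then show ?thesis
      using faces_delete_closing_edge[OF less.prems e(1) faces_bound(1)[OF less.prems False g]]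
        card.remove[OF finF e(2)] by simp
  qed
qed

text \<open>With \<open>f\<close> faces, 5|E| \<le> 5|V| + 5f \<le> 5|V| + 2|E|.\<close>

lemma card_edges_girth_5:
  assumes g: "\<And>xs. cycle E xs \<Longrightarrow> 5 \<le> length xs"
  shows "3 * card E \<le> 5 * card V"
proof (cases "acyclic_graph E")
  case True
  then show ?thesis using card_acyclic_graph[OF graph True] by simp
next
  case False
  then show ?thesis
    using faces_bound(2)[OF order_refl False g] euler_inequality[OF g order_refl] by simp
qed

end

lemma sparse_if_planar:
  assumes "finite V" "simple_graph V E" "planar V E" "5 \<le> girth E" and X: "X \<subseteq> V" "X \<noteq> {}"
  shows "10 * card {e \<in> E. e \<subseteq> X} < 17 * card X"
proof -
  obtain p \<gamma> where pg: "plane_drawing V E p \<gamma>" using assms(3) by (auto simp: planar_def)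
  let ?E = "{e \<in> E. e \<subseteq> X}"
  have "inj_on p X" using pg X inj_on_subset unfolding plane_drawing_def by blast
  moreover have "(path_image (\<gamma> e) - p ` e) \<inter> (p ` X \<union> (\<Union>f\<in>?E - {e}. path_image (\<gamma> f))) = {}"
    if "e \<in> E" for e
  proof -
    have "(path_image (\<gamma> e) - p ` e) \<inter> (p ` V \<union> (\<Union>f\<in>E - {e}. path_image (\<gamma> f))) = {}"
      using pg that unfolding plane_drawing_def by blast
    then show ?thesis using X by blast
  qed
  ultimately have pgX: "plane_drawing X ?E p \<gamma>"
    using pg unfolding plane_drawing_def by blast
  interpret plane_graph X ?E p \<gamma>
    by unfold_locales (use assms(2) pgX finite_subset[OF X(1) assms(1)] in \<open>auto simp: simple_graph_def\<close>)
  have "5 \<le> length xs" if "cycle ?E xs" for xs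
  proof -
    have "girth E \<le> enat (length xs)" unfolding girth_def
      by (rule INF_lower) (use cycle_mono[OF that, of E] in auto)
    then have "5 \<le> enat (length xs)" using assms(4) order_trans by blast
    then show ?thesis by (simp add: numeral_eq_enat)
  qed
  \<comment> \<open>The drawing was restricted to the induced subgraph on \<open>X\<close>, whose
    cycles are cycles of the whole graph. Ten times its number of edges is at most 50/3 of
    \<open>card X\<close>, which is below \<open>17 * card X\<close> because \<open>X\<close> is
    nonempty.\<close>
  then have "3 * card ?E \<le> 5 * card X" by (rule card_edges_girth_5)
  moreover have "0 < card X" using X assms(1) finite_subset by (auto simp: card_gt_0_iff)
  ultimately show ?thesis by simp
qed

theorem theorem3:
  fixes V :: "'a set" and E :: "'a set set"
    and L :: "'a \<Rightarrow> 'c set" and \<alpha> \<beta> :: "'a \<Rightarrow> 'c"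
  assumes "simple_graph V E" and "finite V"
    and "list_assignment 6 V L"
    and "L_coloring V E L \<alpha>" and "L_coloring V E L \<beta>"
  shows "(mad V E < 17 / 5 \<longrightarrow>
            (\<exists>\<phi>s. recoloring_sequence V E L \<phi>s \<and> transforms \<phi>s \<alpha> \<beta> \<and>
                  (\<forall>v\<in>V. times_recolored \<phi>s v \<le> 12))) \<and>
         (planar V E \<and> 5 \<le> girth E \<longrightarrow>
            (\<exists>\<phi>s. recoloring_sequence V E L \<phi>s \<and> transforms \<phi>s \<alpha> \<beta> \<and>
                  (\<forall>v\<in>V. times_recolored \<phi>s v \<le> 12)))"
proof (intro conjI impI)
  assume mad: "mad V E < 17 / 5"
  show "\<exists>\<phi>s. recoloring_sequence V E L \<phi>s \<and> transforms \<phi>s \<alpha> \<beta> \<and>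
    (\<forall>v\<in>V. times_recolored \<phi>s v \<le> 12)"
    by (rule sparse_recoloring[OF assms sparse_if_mad_less[OF assms(2,1) mad]])
next
  assume "planar V E \<and> 5 \<le> girth E"
  then show "\<exists>\<phi>s. recoloring_sequence V E L \<phi>s \<and> transforms \<phi>s \<alpha> \<beta> \<and>
    (\<forall>v\<in>V. times_recolored \<phi>s v \<le> 12)"
    by (intro sparse_recoloring[OF assms sparse_if_planar[OF assms(2,1)]]) auto
qed

end
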